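(* Let $A\in\mathbb{H}^{m\times n}$ have rank $r$, and let $M$ and $N$ be positive definite quaternion matrices of order $m$ and $n$, respectively. There exist $U\in\mathbb{H}^{m\times m}$ and $V\in\mathbb{H}^{n\times n}$ satisfying $U^{*}MU=I_{m}$ and $V^{*}N^{-1}V=I_{n}$ such that $A=UDV^{*}$, where $D=\begin{pmatrix}\Sigma & 0\\ 0& 0\end{pmatrix}\in\mathbb{H}^{m\times n}$. Then the weighted Moore-Penrose inverse $A^{\dagger}_{M,N}$ can be represented as $$A^{\dagger}_{M,N}=N^{-1}V\begin{pmatrix}\Sigma^{-1} & 0\\ 0& 0\end{pmatrix}U^{*}M,$$ where the block matrix here is $n\times m$, $\Sigma=\mathrm{diag}(\sigma_1,\dots,\sigma_r)$, $\sigma_1\ge\sigma_2\ge\dots\ge\sigma_r>0$, and $\sigma_1^2,\dots,\sigma_r^2$ are the nonzero eigenvalues of $A^{\sharp}A$ or of $AA^{\sharp}$, which coincide.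
   Context: $\mathbb{H}$ is the skew field of real quaternions; $\mathbb{H}^{m\times n}$ is the set of $m\times n$ quaternion matrices; $A^{*}$ is the conjugate transpose. A matrix $P\in\mathbb{H}^{n\times n}$ is Hermitian if $P^{*}=P$, and positive definite if it is Hermitian and $x^{*}Px>0$ for every nonzero $x\in\mathbb{H}^{n}$. For given positive definite $M$ (order $m$) and $N$ (order $n$), $A^{\sharp}:=N^{-1}A^{*}M\in\mathbb{H}^{n\times m}$. The weighted Moore-Penrose inverse $A^{\dagger}_{M,N}$ of $A$ is the unique $X\in\mathbb{H}^{n\times m}$ with $AXA=A$, $XAX=X$, $(MAX)^{*}=MAX$, $(NXA)^{*}=NXA$. Eigenvalues are right eigenvalues: $\lambda\in\mathbb{H}$ is a right eigenvalue of $B$ if $Bx=x\lambda$ for some nonzero column $x$; they are listed with multiplicity (for $A^\sharp A$ and $AA^\sharp$ they are real and nonnegative). *)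

theory Defs
  imports Complex_Main "Jordan_Normal_Form.Matrix"
begin

section \<open>Quaternions\<close>

text \<open>
  \<open>Quat a b c d\<close> is $a + b\,i + c\,j + d\,k$ with $i^2 = j^2 = k^2 = ijk = -1$.
\<close>

datatype quat = Quat (qRe: real) (qI: real) (qJ: real) (qK: real)

lemma quat_eq_iff:
  "x = y \<longleftrightarrow> qRe x = qRe y \<and> qI x = qI y \<and> qJ x = qJ y \<and> qK x = qK y"
  by (cases x; cases y) simp

instantiation quat :: real_vector
begin

definition "0 = Quat 0 0 0 0"
definition "x + y = Quat (qRe x + qRe y) (qI x + qI y) (qJ x + qJ y) (qK x + qK y)"
definition "- x = Quat (- qRe x) (- qI x) (- qJ x) (- qK x)"
definition "x - y = Quat (qRe x - qRe y) (qI x - qI y) (qJ x - qJ y) (qK x - qK y)"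
definition "t *\<^sub>R x = Quat (t * qRe x) (t * qI x) (t * qJ x) (t * qK x)"

instance
  by standard
    (simp_all add: zero_quat_def plus_quat_def uminus_quat_def minus_quat_def scaleR_quat_def
      algebra_simps)

end

instantiation quat :: real_div_algebra
begin

definition "1 = Quat 1 0 0 0"

definition "x * y = Quat
   (qRe x * qRe y - qI x * qI y - qJ x * qJ y - qK x * qK y)
   (qRe x * qI y + qI x * qRe y + qJ x * qK y - qK x * qJ y)
   (qRe x * qJ y - qI x * qK y + qJ x * qRe y + qK x * qI y)
   (qRe x * qK y + qI x * qJ y - qJ x * qI y + qK x * qRe y)"

definition "inverse x =
  (let s = (qRe x)\<^sup>2 + (qI x)\<^sup>2 + (qJ x)\<^sup>2 + (qK x)\<^sup>2
   in Quat (qRe x / s) (- qI x / s) (- qJ x / s) (- qK x / s))"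

definition "x div y = x * inverse (y :: quat)"

instance
proof
  fix x y z :: quat and t :: real
  show "x * y * z = x * (y * z)"
    by (simp add: times_quat_def algebra_simps)
  show "(x + y) * z = x * z + y * z" "x * (y + z) = x * y + x * z"
    by (simp_all add: times_quat_def plus_quat_def algebra_simps)
  show "1 * x = x" "x * 1 = x"
    by (simp_all add: times_quat_def one_quat_def)
  show "(0 :: quat) \<noteq> 1"
    by (simp add: zero_quat_def one_quat_def)
  show "t *\<^sub>R x * y = t *\<^sub>R (x * y)" "x * t *\<^sub>R y = t *\<^sub>R (x * y)"
    by (simp_all add: times_quat_def scaleR_quat_def algebra_simps)
  show "x div y = x * inverse y"
    by (simp add: divide_quat_def)
  show "inverse (0 :: quat) = 0"
    by (simp add: inverse_quat_def zero_quat_def)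
  assume nz: "x \<noteq> 0"
  define s where "s = (qRe x)\<^sup>2 + (qI x)\<^sup>2 + (qJ x)\<^sup>2 + (qK x)\<^sup>2"
  have "s \<noteq> 0"
    using nz unfolding s_def
    by (auto simp: quat_eq_iff zero_quat_def add_nonneg_eq_0_iff)
  then have *: "qRe x * qRe x / s + qI x * qI x / s + qJ x * qJ x / s + qK x * qK x / s = 1"
    by (simp add: s_def power2_eq_square add_divide_distrib[symmetric])
  show "inverse x * x = 1" "x * inverse x = 1"
    using * by (simp_all add: inverse_quat_def times_quat_def one_quat_def s_def[symmetric])
qed

end

definition quat_cnj :: "quat \<Rightarrow> quat" where
  "quat_cnj x = Quat (qRe x) (- qI x) (- qJ x) (- qK x)"

section \<open>Quaternion matrices\<close>

text \<open>
  Multiplication in \<open>quat\<close> does not commute.  The products \<open>A * B\<close> and \<open>A *\<^sub>v x\<close> have entries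
  $\sum_k A_{ik} B_{kj}$ and $\sum_k A_{ik} x_k$, factors in this order; so columns form a
  \<^emph>\<open>right\<close> vector space, and \<open>A *\<^sub>v c\<close> is the right linear combination of the columns of
  \<open>A\<close> with coefficients \<open>c\<close>.  The scalar multiple \<open>q \<cdot>\<^sub>v x\<close> of the library multiplies from the
  left, whence a separate operation for $x\lambda$.
\<close>

definition vec_smult_right :: "quat vec \<Rightarrow> quat \<Rightarrow> quat vec" where
  "vec_smult_right x q = map_vec (\<lambda>a. a * q) x"

definition ctranspose :: "quat mat \<Rightarrow> quat mat" where
  "ctranspose A = mat (dim_col A) (dim_row A) (\<lambda>(i, j). quat_cnj (A $$ (j, i)))"

definition qmat_inv :: "quat mat \<Rightarrow> quat mat" where
  "qmat_inv A = (THE B. B \<in> carrier_mat (dim_row A) (dim_row A) \<and>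
     A * B = 1\<^sub>m (dim_row A) \<and> B * A = 1\<^sub>m (dim_row A))"

definition qmat_hermitian :: "nat \<Rightarrow> quat mat \<Rightarrow> bool" where
  "qmat_hermitian n P \<longleftrightarrow> P \<in> carrier_mat n n \<and> ctranspose P = P"

text \<open>A quaternion is positive if it is real and positive as a real number.\<close>

definition qmat_posdef :: "nat \<Rightarrow> quat mat \<Rightarrow> bool" where
  "qmat_posdef n P \<longleftrightarrow> qmat_hermitian n P \<and>
     (\<forall>x \<in> carrier_vec n. x \<noteq> 0\<^sub>v n \<longrightarrow>
        (\<exists>t > 0. map_vec quat_cnj x \<bullet> (P *\<^sub>v x) = of_real t))"

subsection \<open>Right dimension and rank\<close>

definition right_indep :: "nat \<Rightarrow> quat vec list \<Rightarrow> bool" where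
  "right_indep n vs \<longleftrightarrow> set vs \<subseteq> carrier_vec n \<and>
     (\<forall>c \<in> carrier_vec (length vs). mat_of_cols n vs *\<^sub>v c = 0\<^sub>v n \<longrightarrow> c = 0\<^sub>v (length vs))"

definition right_dim :: "nat \<Rightarrow> quat vec set \<Rightarrow> nat" where
  "right_dim n S = Max {length vs |vs. set vs \<subseteq> S \<and> right_indep n vs}"

definition qmat_rank :: "quat mat \<Rightarrow> nat" where
  "qmat_rank A = right_dim (dim_row A) {A *\<^sub>v x |x. x \<in> carrier_vec (dim_col A)}"

subsection \<open>Right eigenvalues\<close>

definition right_eigenvalue :: "quat mat \<Rightarrow> quat \<Rightarrow> bool" where
  "right_eigenvalue B q \<longleftrightarrow>
     (\<exists>x \<in> carrier_vec (dim_row B). x \<noteq> 0\<^sub>v (dim_row B) \<and> B *\<^sub>v x = vec_smult_right x q)"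

text \<open>
  The algebraic multiplicity of a \<^emph>\<open>real\<close> number as an eigenvalue of a square matrix: the right
  dimension of the generalized eigenspace.  Since $t$ is real, $tI$ is central, so
  $\{x \mid (B - tI)^n x = 0\}$ is a right subspace and $Bx = xt$ means $(B - tI)x = 0$.
  (This fails for a non-real quaternion, whose eigenvectors do not form a subspace.)
\<close>

definition real_eigenvalue_mult :: "quat mat \<Rightarrow> real \<Rightarrow> nat" where
  "real_eigenvalue_mult B t = (let n = dim_row B in
     right_dim n {x \<in> carrier_vec n. ((B - of_real t \<cdot>\<^sub>m 1\<^sub>m n) ^\<^sub>m n) *\<^sub>v x = 0\<^sub>v n})"

text \<open>
  \<open>\<tau> 0, \<dots>, \<tau> (r - 1)\<close> are all the nonzero right eigenvalues of \<open>B\<close>, listed with multiplicity;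
  in particular, every nonzero right eigenvalue of \<open>B\<close> is real.
\<close>

definition nonzero_eigenvalues_are :: "quat mat \<Rightarrow> nat \<Rightarrow> (nat \<Rightarrow> real) \<Rightarrow> bool" where
  "nonzero_eigenvalues_are B r \<tau> \<longleftrightarrow>
     {q. q \<noteq> 0 \<and> right_eigenvalue B q} = {of_real (\<tau> i) |i. i < r} \<and>
     (\<forall>t. t \<noteq> 0 \<longrightarrow> real_eigenvalue_mult B t = card {i. i < r \<and> \<tau> i = t})"

section \<open>Weighted adjoint, Moore-Penrose inverse and singular value decomposition\<close>

definition weighted_adjoint :: "quat mat \<Rightarrow> quat mat \<Rightarrow> quat mat \<Rightarrow> quat mat" where
  "weighted_adjoint M N A = qmat_inv N * ctranspose A * M"

definition is_weighted_mp_inverse ::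
  "quat mat \<Rightarrow> quat mat \<Rightarrow> quat mat \<Rightarrow> quat mat \<Rightarrow> bool" where
  "is_weighted_mp_inverse M N A X \<longleftrightarrow>
     X \<in> carrier_mat (dim_col A) (dim_row A) \<and>
     A * X * A = A \<and> X * A * X = X \<and>
     ctranspose (M * A * X) = M * A * X \<and> ctranspose (N * X * A) = N * X * A"

definition weighted_mp_inverse :: "quat mat \<Rightarrow> quat mat \<Rightarrow> quat mat \<Rightarrow> quat mat" where
  "weighted_mp_inverse M N A = (THE X. is_weighted_mp_inverse M N A X)"

definition sigma_mat :: "nat \<Rightarrow> (nat \<Rightarrow> real) \<Rightarrow> quat mat" where
  "sigma_mat r \<sigma> = mat_diag r (\<lambda>i. of_real (\<sigma> i))"

text \<open>The $m \times n$ matrix with upper left block \<open>S\<close> and all other blocks zero.\<close>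

definition pad_zero :: "nat \<Rightarrow> nat \<Rightarrow> quat mat \<Rightarrow> quat mat" where
  "pad_zero m n S = four_block_mat
     S (0\<^sub>m (dim_row S) (n - dim_col S))
     (0\<^sub>m (m - dim_row S) (dim_col S)) (0\<^sub>m (m - dim_row S) (n - dim_col S))"

definition is_weighted_svd ::
  "nat \<Rightarrow> nat \<Rightarrow> nat \<Rightarrow> quat mat \<Rightarrow> quat mat \<Rightarrow> quat mat \<Rightarrow>
   quat mat \<Rightarrow> quat mat \<Rightarrow> (nat \<Rightarrow> real) \<Rightarrow> bool" where
  "is_weighted_svd m n r M N A U V \<sigma> \<longleftrightarrow>
     U \<in> carrier_mat m m \<and> V \<in> carrier_mat n n \<and>
     ctranspose U * M * U = 1\<^sub>m m \<and> ctranspose V * qmat_inv N * V = 1\<^sub>m n \<and>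
     (\<forall>i < r. 0 < \<sigma> i) \<and> (\<forall>i j. i \<le> j \<and> j < r \<longrightarrow> \<sigma> j \<le> \<sigma> i) \<and>
     A = U * pad_zero m n (sigma_mat r \<sigma>) * ctranspose V"

end

theory Submission
  imports Defs "Jordan_Normal_Form.Spectral_Radius"
begin

text \<open>
  Take bases \<open>U\<close>, \<open>W\<close> of the two spaces that are orthonormal for \<open>M\<close> and \<open>N\<close>, and put
  \<open>V = N W\<close>: then $V^* = W^{-1}$, and $A = U D V^*$ says $A W = U D$.  Such \<open>W\<close> comes from the
  spectral theorem for the Hermitian matrix $W_0^* A^* M A W_0$, where \<open>W\<^sub>0\<close> is any
  \<open>N\<close>-orthonormal basis; normalizing the nonzero columns of $A W$ gives the first columns of \<open>U\<close>.
  Eigenvectors exist since $\mathbb{H}^n$ is $\mathbb{C}^{2n}$ with scalars acting on the right.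
  For any weighted decomposition, the four Penrose equations reduce to identities between diagonal
  matrices, while $A^\sharp A$ and $A A^\sharp$ are similar to $D^* D$ and $D D^*$.
\<close>

text \<open>The usual determinant and characteristic polynomial fail over a noncommutative ring, so
  orthogonal complements, the passage from one-sided to two-sided inverses and all dimension bounds
  are drawn from one fact: fewer homogeneous equations than unknowns have a nontrivial solution.
  Only real scalars are central; hence eigenvalues are shown to be real early on, and diagonal
  matrices carry real entries. The construction does not start from the rank: it yields some number
  \<open>s\<close> of positive singular values, and the rank is then computed from the decomposition
  to be \<open>s\<close>. The formula and the eigenvalues are treated for every decomposition,
  because \<open>U\<close> and \<open>V\<close> are not determined by \<open>A\<close>; the
  constructed one contributes to that half only the bounds on \<open>r\<close>.\<close>

section \<open>Linear systems over a division ring\<close>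

text \<open>Unlike the carrier premises of \<open>assoc_mult_mat\<close>, these premises leave no dimension for
  the simplifier to guess.\<close>

lemma mat_mult_assoc:
  fixes A B C :: "'a::semiring_0 mat"
  shows "dim_col A = dim_row B \<Longrightarrow> dim_col B = dim_row C \<Longrightarrow> A * B * C = A * (B * C)"
  by (rule assoc_mult_mat[of A "dim_row A" "dim_row B" B "dim_row C" C "dim_col C"]) auto

text \<open>Elimination by induction on the equations: one with a nonzero coefficient at
  \<open>p\<close> is solved for \<open>x p\<close>, and substitution leaves one equation and one
  unknown less. Unknowns stand to the right of coefficients, which fixes the order of the factors in
  \<open>b'\<close>.\<close>

lemma exists_nontrivial_solution:
  fixes b :: "'i \<Rightarrow> 'j \<Rightarrow> 'a::division_ring"
  assumes "finite I" "finite J" "card I < card J"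
  shows "\<exists>x. (\<exists>j\<in>J. x j \<noteq> 0) \<and> (\<forall>i\<in>I. (\<Sum>j\<in>J. b i j * x j) = 0)"
  using assms
proof (induction I arbitrary: J b rule: finite_induct)
  case empty
  then have "J \<noteq> {}" by auto
  then show ?case by (intro exI[of _ "\<lambda>_. 1"]) auto
next
  case (insert k I)
  show ?case
  proof (cases "\<forall>j\<in>J. b k j = 0")
    case True
    obtain x where "\<exists>j\<in>J. x j \<noteq> 0" "\<forall>i\<in>I. (\<Sum>j\<in>J. b i j * x j) = 0"
      using insert.IH[of J b] insert.prems insert.hyps by auto
    then show ?thesis using True by (intro exI[of _ x]) auto
  next
    case False
    then obtain p where p: "p \<in> J" "b k p \<noteq> 0" by auto
    define J' where "J' = J - {p}"
    define b' where "b' i j = b i j - b i p * inverse (b k p) * b k j" for i j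
    have J': "finite J'" "card I < card J'" "J = insert p J'" "p \<notin> J'"
      using insert p by (auto simp: J'_def)
    obtain x where x: "\<exists>j\<in>J'. x j \<noteq> 0" "\<forall>i\<in>I. (\<Sum>j\<in>J'. b' i j * x j) = 0"
      using insert.IH[of J' b'] J' by auto
    define s where "s = (\<Sum>j\<in>J'. b k j * x j)"
    define y where "y = x(p := - (inverse (b k p) * s))"
    have split: "(\<Sum>j\<in>J. b i j * y j) = - (b i p * (inverse (b k p) * s)) + (\<Sum>j\<in>J'. b i j * x j)" for i
    proof -
      have "(\<Sum>j\<in>J'. b i j * y j) = (\<Sum>j\<in>J'. b i j * x j)"
        using J' by (intro sum.cong) (auto simp: y_def)
      then show ?thesis using J' by (simp add: y_def)
    qed
    have "(\<Sum>j\<in>J. b i j * y j) = 0" if "i \<in> I" for i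
    proof -
      have "(\<Sum>j\<in>J'. b' i j * x j) = (\<Sum>j\<in>J'. b i j * x j) - b i p * (inverse (b k p) * s)"
        by (simp add: b'_def s_def left_diff_distrib sum_subtractf sum_distrib_left mult.assoc)
      then show ?thesis using x that split[of i] by auto
    qed
    moreover have "(\<Sum>j\<in>J. b k j * y j) = 0"
      using p split[of k] by (simp add: s_def[symmetric] mult.assoc[symmetric])
    moreover have "\<exists>j\<in>J. y j \<noteq> 0" using x J' by (auto simp: y_def)
    ultimately show ?thesis by auto
  qed
qed

lemma mult_mat_zero_vec: "A \<in> carrier_mat m n \<Longrightarrow> A *\<^sub>v 0\<^sub>v n = (0\<^sub>v m :: 'a::semiring_0 vec)"
  by (intro eq_vecI) auto

lemma mat_exists_kernel_vec:
  fixes B :: "'a::division_ring mat"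
  assumes "B \<in> carrier_mat k n" "k < n"
  shows "\<exists>x \<in> carrier_vec n. x \<noteq> 0\<^sub>v n \<and> B *\<^sub>v x = 0\<^sub>v k"
proof -
  obtain x where x: "\<exists>j\<in>{..<n}. x j \<noteq> 0" "\<forall>i\<in>{..<k}. (\<Sum>j\<in>{..<n}. B $$ (i, j) * x j) = 0"
    using exists_nontrivial_solution[of "{..<k}" "{..<n}" "\<lambda>i j. B $$ (i, j)"] assms by auto
  show ?thesis
  proof (intro bexI[of _ "vec n x"] conjI)
    show "vec n x \<noteq> 0\<^sub>v n" using x by (auto simp: vec_eq_iff)
    show "B *\<^sub>v vec n x = 0\<^sub>v k"
      using x assms by (auto simp: vec_eq_iff scalar_prod_def lessThan_atLeast0)
  qed auto
qed

text \<open>From \<open>A B = I\<close>, the matrix \<open>B\<close> is injective. For a column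
  index \<open>k\<close>, the columns of \<open>B\<close> together with the \<open>k\<close>-th unit
  vector are \<open>n + 1\<close> columns of height \<open>n\<close>, so they satisfy a nontrivial
  relation; injectivity forces a nonzero coefficient at the unit vector, and dividing by it gives
  column \<open>k\<close> of some \<open>C\<close> with \<open>B C = I\<close>. Then
  \<open>A = A (B C) = C\<close>.\<close>

lemma mat_left_inverse_imp_right_inverse:
  fixes A B :: "'a::division_ring mat"
  assumes A: "A \<in> carrier_mat n n" and B: "B \<in> carrier_mat n n" and AB: "A * B = 1\<^sub>m n"
  shows "B * A = 1\<^sub>m n"
proof -
  have "\<exists>c. \<forall>i<n. (\<Sum>j<n. B $$ (i, j) * c j) = (if i = k then 1 else 0)" for k
  proof -
    define b where "b i j = (if j < n then B $$ (i, j) else if i = k then 1 else 0)" for i j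
    obtain x where x: "\<exists>j\<in>{..<Suc n}. x j \<noteq> 0" "\<forall>i\<in>{..<n}. (\<Sum>j\<in>{..<Suc n}. b i j * x j) = 0"
      using exists_nontrivial_solution[of "{..<n}" "{..<Suc n}" b] by auto
    have eq: "(\<Sum>j<n. B $$ (i, j) * x j) + (if i = k then x n else 0) = 0" if "i < n" for i
    proof -
      have "(\<Sum>j<n. b i j * x j) = (\<Sum>j<n. B $$ (i, j) * x j)"
        by (intro sum.cong) (auto simp: b_def)
      then show ?thesis using x(2)[rule_format, of i] that by (auto simp: b_def)
    qed
    have "x n \<noteq> 0"
    proof
      assume 0: "x n = 0"
      have "B *\<^sub>v vec n x = 0\<^sub>v n"
        using eq B unfolding 0 by (auto simp: vec_eq_iff scalar_prod_def lessThan_atLeast0)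
      moreover have "A *\<^sub>v (B *\<^sub>v vec n x) = (A * B) *\<^sub>v vec n x"
        using A B by (simp add: assoc_mult_mat_vec[of _ n n _ n])
      ultimately have "vec n x = 0\<^sub>v n" using A AB by (simp add: mult_mat_zero_vec)
      then have "\<forall>j<n. x j = 0" by (auto simp: vec_eq_iff)
      then show False using x(1) 0 less_Suc_eq by auto
    qed
    then have "(\<Sum>j<n. B $$ (i, j) * (- (x j * inverse (x n)))) = (if i = k then 1 else 0)"
      if "i < n" for i
    proof -
      have "(\<Sum>j<n. B $$ (i, j) * (- (x j * inverse (x n)))) = - (\<Sum>j<n. B $$ (i, j) * x j) * inverse (x n)"
        by (simp add: sum_distrib_right sum_negf mult.assoc)
      moreover have "- (\<Sum>j<n. B $$ (i, j) * x j) = (if i = k then x n else 0)"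
        using eq[OF that] by (rule minus_unique)
      ultimately show ?thesis using \<open>x n \<noteq> 0\<close> by auto
    qed
    then show ?thesis by (intro exI[of _ "\<lambda>j. - (x j * inverse (x n))"]) auto
  qed
  then obtain c where c: "\<And>k i. i < n \<Longrightarrow> (\<Sum>j<n. B $$ (i, j) * c k j) = (if i = k then 1 else 0)"
    by metis
  define C where "C = mat n n (\<lambda>(j, k). c k j)"
  have C: "C \<in> carrier_mat n n" by (simp add: C_def)
  have BC: "B * C = 1\<^sub>m n"
    using B c by (intro eq_matI) (auto simp: C_def scalar_prod_def lessThan_atLeast0)
  have "A = A * (B * C)" using A BC by simp
  also have "\<dots> = (A * B) * C" using A B C by (intro assoc_mult_mat[symmetric]) auto
  also have "\<dots> = C" unfolding AB using C by simp
  finally show ?thesis using BC by simp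
qed

section \<open>Quaternions\<close>

lemma quat_cnj_simps [simp]:
  "qRe (quat_cnj x) = qRe x" "qI (quat_cnj x) = - qI x"
  "qJ (quat_cnj x) = - qJ x" "qK (quat_cnj x) = - qK x"
  by (simp_all add: quat_cnj_def)

lemma quat_sel_simps:
  "qRe (x + y) = qRe x + qRe y" "qI (x + y) = qI x + qI y"
  "qJ (x + y) = qJ x + qJ y" "qK (x + y) = qK x + qK y"
  "qRe 0 = 0" "qI 0 = 0" "qJ 0 = 0" "qK 0 = 0"
  "qRe (of_real t) = t" "qI (of_real t) = 0" "qJ (of_real t) = 0" "qK (of_real t) = 0"
  by (simp_all add: plus_quat_def zero_quat_def of_real_def one_quat_def scaleR_quat_def)

lemma quat_cnj_add: "quat_cnj (x + y) = quat_cnj x + quat_cnj y"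
  by (simp add: quat_cnj_def plus_quat_def)

lemma quat_cnj_mult: "quat_cnj (x * y) = quat_cnj y * quat_cnj x"
  by (simp add: quat_cnj_def times_quat_def algebra_simps)

lemma quat_cnj_of_real [simp]: "quat_cnj (of_real t) = of_real t"
  by (simp add: quat_eq_iff quat_sel_simps)

lemma quat_cnj_0 [simp]: "quat_cnj 0 = 0" and quat_cnj_1 [simp]: "quat_cnj 1 = 1"
  using quat_cnj_of_real[of 0] quat_cnj_of_real[of 1] by simp_all

lemma quat_cnj_cnj [simp]: "quat_cnj (quat_cnj x) = x"
  by (simp add: quat_eq_iff)

lemma quat_cnj_sum: "quat_cnj (sum f S) = (\<Sum>i\<in>S. quat_cnj (f i))"
  by (induction S rule: infinite_finite_induct) (auto simp: quat_cnj_add)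

lemma quat_cnj_eq_self_iff: "quat_cnj x = x \<longleftrightarrow> x = of_real (qRe x)"
  by (auto simp: quat_eq_iff quat_sel_simps)

lemma quat_of_real_commute: "of_real t * (x :: quat) = x * of_real t"
  by (simp add: of_real_def)

lemma quat_cnj_mult_self:
  "quat_cnj x * x = of_real ((qRe x)\<^sup>2 + (qI x)\<^sup>2 + (qJ x)\<^sup>2 + (qK x)\<^sup>2)"
  by (simp only: quat_eq_iff quat_sel_simps) (simp add: times_quat_def power2_eq_square)

section \<open>Conjugate transposes and diagonal quaternion matrices\<close>

lemma ctranspose_carrier [simp]: "A \<in> carrier_mat m n \<Longrightarrow> ctranspose A \<in> carrier_mat n m"
  by (auto simp: ctranspose_def)

lemma ctranspose_dim [simp]:
  "dim_row (ctranspose A) = dim_col A" "dim_col (ctranspose A) = dim_row A"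
  by (simp_all add: ctranspose_def)

lemma ctranspose_index [simp]:
  "i < dim_col A \<Longrightarrow> j < dim_row A \<Longrightarrow> ctranspose A $$ (i, j) = quat_cnj (A $$ (j, i))"
  by (simp add: ctranspose_def)

lemma ctranspose_ctranspose [simp]: "ctranspose (ctranspose A) = A"
  by (intro eq_matI) auto

lemma ctranspose_one [simp]: "ctranspose (1\<^sub>m n) = 1\<^sub>m n"
  by (intro eq_matI) auto

lemma ctranspose_mult:
  assumes "dim_col A = dim_row B"
  shows "ctranspose (A * B) = ctranspose B * ctranspose A"
  using assms by (intro eq_matI) (auto simp: scalar_prod_def quat_cnj_sum quat_cnj_mult)

text \<open>Rectangular, so that one family contains \<open>D\<close>, its adjoint, the padded
  inverse of Sigma and their products; real entries, so that the adjoint only swaps the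
  dimensions.\<close>

definition rdiag :: "nat \<Rightarrow> nat \<Rightarrow> (nat \<Rightarrow> real) \<Rightarrow> quat mat" where
  "rdiag m n f = mat m n (\<lambda>(i, j). if i = j then of_real (f i) else 0)"

lemma rdiag_carrier [simp]: "rdiag m n f \<in> carrier_mat m n"
  and rdiag_dim [simp]: "dim_row (rdiag m n f) = m" "dim_col (rdiag m n f) = n"
  and rdiag_index [simp]:
    "i < m \<Longrightarrow> j < n \<Longrightarrow> rdiag m n f $$ (i, j) = (if i = j then of_real (f i) else 0)"
  by (auto simp: rdiag_def)

lemma rdiag_cong: "(\<And>i. i < m \<Longrightarrow> i < n \<Longrightarrow> f i = g i) \<Longrightarrow> rdiag m n f = rdiag m n g"
  by (intro eq_matI) auto

lemma rdiag_one: "rdiag n n (\<lambda>_. 1) = 1\<^sub>m n"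
  by (intro eq_matI) auto

lemma ctranspose_rdiag [simp]: "ctranspose (rdiag m n f) = rdiag n m f"
  by (intro eq_matI) auto

text \<open>The product passes through \<open>n\<close> intermediate coordinates, so diagonal
  entries from position \<open>n\<close> on vanish whatever \<open>f\<close> and \<open>g\<close>
  are there.\<close>

lemma rdiag_mult:
  "rdiag m n f * rdiag n k g = rdiag m k (\<lambda>i. if i < n then f i * g i else 0)"
proof (intro eq_matI)
  fix i j assume ij: "i < dim_row (rdiag m k (\<lambda>i. if i < n then f i * g i else 0))"
    "j < dim_col (rdiag m k (\<lambda>i. if i < n then f i * g i else 0))"
  have "(rdiag m n f * rdiag n k g) $$ (i, j) =
    (\<Sum>l = 0..<n. rdiag m n f $$ (i, l) * rdiag n k g $$ (l, j))"
    using ij by (auto simp: scalar_prod_def)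
  also have "\<dots> = (\<Sum>l = 0..<n. if l = i then (if i = j then of_real (f i * g i) else 0) else 0)"
    using ij by (intro sum.cong) auto
  also have "\<dots> = (rdiag m k (\<lambda>i. if i < n then f i * g i else 0)) $$ (i, j)"
    using ij by (subst sum.delta) auto
  finally show "(rdiag m n f * rdiag n k g) $$ (i, j) = \<dots>" .
qed auto

lemma rdiag_mult_vec_index:
  assumes "x \<in> carrier_vec n" "i < m"
  shows "(rdiag m n f *\<^sub>v x) $ i = (if i < n then of_real (f i) * x $ i else 0)"
proof -
  have "(rdiag m n f *\<^sub>v x) $ i = (\<Sum>l = 0..<n. rdiag m n f $$ (i, l) * x $ l)"
    using assms by (auto simp: scalar_prod_def)
  also have "\<dots> = (\<Sum>l = 0..<n. if l = i then of_real (f i) * x $ i else 0)"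
    using assms by (intro sum.cong) auto
  finally show ?thesis by (subst (asm) sum.delta) auto
qed

text \<open>The bounds make the truncated subtractions in \<open>pad_zero\<close> exact. All later
  computations use the form on the right.\<close>

lemma pad_zero_sigma_mat:
  assumes "r \<le> m" "r \<le> n"
  shows "pad_zero m n (sigma_mat r \<sigma>) = rdiag m n (\<lambda>i. if i < r then \<sigma> i else 0)"
  using assms by (intro eq_matI) (auto simp: pad_zero_def sigma_mat_def mat_diag_def)

text \<open>One product is enough, since a one-sided inverse of a square matrix is
  two-sided.\<close>

lemma qmat_inv_eq:
  assumes "A \<in> carrier_mat n n" "B \<in> carrier_mat n n" "A * B = 1\<^sub>m n"
  shows "qmat_inv A = B"
  unfolding qmat_inv_def
proof (rule the_equality)
  show "B \<in> carrier_mat (dim_row A) (dim_row A) \<and> A * B = 1\<^sub>m (dim_row A) \<and> B * A = 1\<^sub>m (dim_row A)"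
    using assms mat_left_inverse_imp_right_inverse[of A n B] by auto
  fix C assume "C \<in> carrier_mat (dim_row A) (dim_row A) \<and> A * C = 1\<^sub>m (dim_row A) \<and> C * A = 1\<^sub>m (dim_row A)"
  then have C: "C \<in> carrier_mat n n" "C * A = 1\<^sub>m n" using assms by auto
  have "C = C * (A * B)" using C assms by simp
  also have "\<dots> = (C * A) * B" using C assms by (intro assoc_mult_mat[symmetric]) auto
  also have "\<dots> = B" unfolding C(2) using assms by simp
  finally show "C = B" .
qed

lemma qmat_inv_sigma_mat:
  assumes "\<forall>i<r. 0 < \<sigma> i"
  shows "qmat_inv (sigma_mat r \<sigma>) = sigma_mat r (\<lambda>i. inverse (\<sigma> i))"
proof (rule qmat_inv_eq)
  show "sigma_mat r \<sigma> * sigma_mat r (\<lambda>i. inverse (\<sigma> i)) = 1\<^sub>m r"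
    unfolding sigma_mat_def using assms
    by (simp, intro eq_matI) (auto simp: mat_diag_def simp flip: of_real_mult)
qed (auto simp: sigma_mat_def)

section \<open>Orthonormal systems for a positive definite matrix\<close>

text \<open>The form attached to a weight: \<open>M\<close> and \<open>N\<close> give the two
  weighted inner products, the identity gives the standard one for the spectral theorem, and a
  Hermitian \<open>H\<close> gives its own entries in another basis.\<close>

definition wip :: "quat mat \<Rightarrow> quat vec \<Rightarrow> quat vec \<Rightarrow> quat" where
  "wip P x y = map_vec quat_cnj x \<bullet> (P *\<^sub>v y)"

lemma vec_smult_right_carrier [simp]: "x \<in> carrier_vec n \<Longrightarrow> vec_smult_right x q \<in> carrier_vec n"
  and vec_smult_right_dim [simp]: "dim_vec (vec_smult_right x q) = dim_vec x"
  and vec_smult_right_index [simp]: "i < dim_vec x \<Longrightarrow> vec_smult_right x q $ i = x $ i * q"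
  by (auto simp: vec_smult_right_def)

lemma mult_mat_vec_smult_right:
  assumes "A \<in> carrier_mat m n" "x \<in> carrier_vec n"
  shows "A *\<^sub>v vec_smult_right x q = vec_smult_right (A *\<^sub>v x) q"
  using assms by (intro eq_vecI) (auto simp: scalar_prod_def sum_distrib_right mult.assoc)

lemma wip_eq_sum:
  assumes "P \<in> carrier_mat n n" "x \<in> carrier_vec n" "y \<in> carrier_vec n"
  shows "wip P x y = (\<Sum>i<n. \<Sum>j<n. quat_cnj (x $ i) * P $$ (i, j) * y $ j)"
  using assms by (simp add: wip_def scalar_prod_def sum_distrib_left mult.assoc lessThan_atLeast0)

lemma wip_smult_right:
  assumes "P \<in> carrier_mat n n" "x \<in> carrier_vec n" "y \<in> carrier_vec n"
  shows "wip P x (vec_smult_right y q) = wip P x y * q"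
  using assms by (simp add: wip_eq_sum sum_distrib_right mult.assoc)

lemma wip_smult_left:
  assumes "P \<in> carrier_mat n n" "x \<in> carrier_vec n" "y \<in> carrier_vec n"
  shows "wip P (vec_smult_right x q) y = quat_cnj q * wip P x y"
  using assms by (simp add: wip_eq_sum sum_distrib_left mult.assoc quat_cnj_mult)

lemma wip_cnj:
  assumes "qmat_hermitian n P" "x \<in> carrier_vec n" "y \<in> carrier_vec n"
  shows "quat_cnj (wip P x y) = wip P y x"
proof -
  have P: "P \<in> carrier_mat n n" "ctranspose P = P" using assms by (auto simp: qmat_hermitian_def)
  have "quat_cnj (P $$ (i, j)) = P $$ (j, i)" if "i < n" "j < n" for i j
    using ctranspose_index[of j P i] P that by auto
  then have "quat_cnj (wip P x y) = (\<Sum>i<n. \<Sum>j<n. quat_cnj (y $ j) * P $$ (j, i) * x $ i)"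
    using assms P by (simp add: wip_eq_sum quat_cnj_sum quat_cnj_mult mult.assoc)
  also have "\<dots> = wip P y x"
    using assms P by (subst sum.swap) (simp add: wip_eq_sum)
  finally show ?thesis .
qed

text \<open>Passage between matrix identities such as \<open>U^* M U = I\<close> and products of
  single columns, where scaling, appending and permuting columns are easy to follow.\<close>

lemma gram_index:
  assumes "P \<in> carrier_mat m m" "U \<in> carrier_mat m k" "i < k" "j < k"
  shows "(ctranspose U * P * U) $$ (i, j) = wip P (col U i) (col U j)"
proof -
  have "ctranspose U * P * U = ctranspose U * (P * U)"
    using assms by (intro assoc_mult_mat) auto
  moreover have "row (ctranspose U) i = map_vec quat_cnj (col U i)"
    using assms by (intro eq_vecI) auto
  moreover have "col (P * U) j = P *\<^sub>v col U j"
    using assms by (intro eq_vecI) auto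
  ultimately show ?thesis using assms by (simp add: wip_def)
qed

lemma gram_eqI:
  assumes "P \<in> carrier_mat m m" "U \<in> carrier_mat m k" "G \<in> carrier_mat k k"
    and "\<And>i j. i < k \<Longrightarrow> j < k \<Longrightarrow> wip P (col U i) (col U j) = G $$ (i, j)"
  shows "ctranspose U * P * U = G"
proof (rule eq_matI)
  show "(ctranspose U * P * U) $$ (i, j) = G $$ (i, j)" if "i < dim_row G" "j < dim_col G" for i j
    using that assms gram_index[of P m U k i j] by auto
qed (use assms in auto)

lemma qmat_posdefD:
  assumes "qmat_posdef n P"
  shows "qmat_hermitian n P" "P \<in> carrier_mat n n" "ctranspose P = P"
  using assms by (auto simp: qmat_posdef_def qmat_hermitian_def)

lemma qmat_posdef_wip:
  assumes "qmat_posdef n P" "x \<in> carrier_vec n" "x \<noteq> 0\<^sub>v n"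
  shows "\<exists>t>0. wip P x x = of_real t"
  using assms by (auto simp: qmat_posdef_def wip_def)

text \<open>The squared moduli of the coordinates add up to a positive real. Through this instance
  the results on weighted forms also serve the unweighted one.\<close>

lemma qmat_posdef_one: "qmat_posdef n (1\<^sub>m n)"
  unfolding qmat_posdef_def qmat_hermitian_def
proof (intro conjI ballI impI)
  fix x :: "quat vec" assume x: "x \<in> carrier_vec n" "x \<noteq> 0\<^sub>v n"
  let ?s = "\<lambda>q. (qRe q)\<^sup>2 + (qI q)\<^sup>2 + (qJ q)\<^sup>2 + (qK q)\<^sup>2"
  obtain i where i: "i < n" "x $ i \<noteq> 0" using x by (auto simp: vec_eq_iff)
  have "?s (x $ i) \<noteq> 0" using i(2) by (auto simp: quat_eq_iff quat_sel_simps add_nonneg_eq_0_iff)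
  then have "0 < ?s (x $ i)" by (simp add: order_less_le)
  then have "0 < (\<Sum>i<n. ?s (x $ i))" using i by (intro sum_pos2[of _ i]) auto
  moreover have "map_vec quat_cnj x \<bullet> (1\<^sub>m n *\<^sub>v x) = of_real (\<Sum>i<n. ?s (x $ i))"
    unfolding of_real_sum quat_cnj_mult_self[symmetric] using x
    by (simp add: scalar_prod_def lessThan_atLeast0)
  ultimately show "\<exists>t>0. map_vec quat_cnj x \<bullet> (1\<^sub>m n *\<^sub>v x) = of_real t" by blast
qed auto

lemma wip_normalize:
  assumes P: "qmat_posdef n P" and x: "x \<in> carrier_vec n" "x \<noteq> 0\<^sub>v n"
  shows "\<exists>s. wip P (vec_smult_right x (of_real s)) (vec_smult_right x (of_real s)) = 1"
proof -
  obtain t where t: "t > 0" "wip P x x = of_real t" using qmat_posdef_wip[OF assms] by auto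
  define s where "s = 1 / sqrt t"
  have "wip P (vec_smult_right x (of_real s)) (vec_smult_right x (of_real s)) = of_real (s * (t * s))"
    using qmat_posdefD[OF P] x t by (simp add: wip_smult_left[of _ n] wip_smult_right[of _ n] mult.assoc)
  also have "s * (t * s) = 1" using t by (simp add: s_def field_simps)
  finally show ?thesis by (metis of_real_1)
qed

text \<open>For \<open>k > m\<close> there is a nontrivial relation \<open>U c = 0\<close>, which
  contradicts that \<open>U^* P\<close> is a left inverse of \<open>U\<close>.\<close>

lemma orthonormal_card_le:
  assumes P: "P \<in> carrier_mat m m" and U: "U \<in> carrier_mat m k"
    and orth: "ctranspose U * P * U = 1\<^sub>m k"
  shows "k \<le> m"
proof (rule ccontr)
  assume "\<not> k \<le> m"
  then obtain c where c: "c \<in> carrier_vec k" "c \<noteq> 0\<^sub>v k" "U *\<^sub>v c = 0\<^sub>v m"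
    using mat_exists_kernel_vec[OF U] by auto
  have "c = (ctranspose U * P * U) *\<^sub>v c" unfolding orth using c by simp
  also have "\<dots> = (ctranspose U * P) *\<^sub>v (U *\<^sub>v c)"
    using P U c by (intro assoc_mult_mat_vec) auto
  also have "\<dots> = 0\<^sub>v k" unfolding c(3) using P U by (intro mult_mat_zero_vec) auto
  finally show False using c(2) by simp
qed

text \<open>A vector orthogonal to \<open>k < m\<close> given ones solves \<open>k\<close> equations
  in \<open>m\<close> unknowns, so it exists without any projection; it is normalized and appended.
  The given columns stay in front, where an eigenvector or the normalized columns of
  \<open>A W\<close> will be needed.\<close>

lemma orthonormal_extend:
  assumes P: "qmat_posdef m P"
  shows "U \<in> carrier_mat m k \<Longrightarrow> ctranspose U * P * U = 1\<^sub>m k \<Longrightarrow>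
    \<exists>W \<in> carrier_mat m m. ctranspose W * P * W = 1\<^sub>m m \<and> (\<forall>j<k. col W j = col U j)"
proof (induction "m - k" arbitrary: k U)
  case 0
  then have "k = m" using orthonormal_card_le[of P m U k] qmat_posdefD[OF P] by auto
  then show ?case using 0 by blast
next
  case (Suc l)
  have Pc: "P \<in> carrier_mat m m" using qmat_posdefD[OF P] by auto
  have UP: "ctranspose U * P \<in> carrier_mat k m" "k < m" using Pc Suc by auto
  obtain v where v: "v \<in> carrier_vec m" "v \<noteq> 0\<^sub>v m" "(ctranspose U * P) *\<^sub>v v = 0\<^sub>v k"
    using mat_exists_kernel_vec[OF UP] by auto
  obtain s where s: "wip P (vec_smult_right v (of_real s)) (vec_smult_right v (of_real s)) = 1"
    using wip_normalize[OF P v(1,2)] by auto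
  define u where "u = vec_smult_right v (of_real s)"
  have u: "u \<in> carrier_vec m" "wip P u u = 1" using v s by (simp_all add: u_def)
  have Uc: "col U i \<in> carrier_vec m" if "i < k" for i using Suc.prems(1) that by auto
  have Uu: "wip P (col U i) u = 0" if i: "i < k" for i
  proof -
    have "(ctranspose U * P) *\<^sub>v v = ctranspose U *\<^sub>v (P *\<^sub>v v)"
      using Pc Suc.prems v by (intro assoc_mult_mat_vec) auto
    then have "(ctranspose U *\<^sub>v (P *\<^sub>v v)) $ i = 0" using v(3) i by (metis index_zero_vec(1))
    moreover have "row (ctranspose U) i = map_vec quat_cnj (col U i)"
      using Suc.prems i by (intro eq_vecI) auto
    ultimately have "wip P (col U i) v = 0" using Suc.prems i by (simp add: wip_def)
    then show ?thesis using Uc[OF i] v Pc by (simp add: u_def wip_smult_right[of _ m])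
  qed
  have uU: "wip P u (col U i) = 0" if i: "i < k" for i
    using wip_cnj[OF qmat_posdefD(1)[OF P] Uc[OF i] u(1)] Uu[OF i] by simp
  have UU: "wip P (col U i) (col U j) = (if i = j then 1 else 0)" if "i < k" "j < k" for i j
    using gram_index[OF Pc Suc.prems(1) that] Suc.prems(2) that by simp
  define U' where "U' = mat m (Suc k) (\<lambda>(i, j). if j < k then U $$ (i, j) else u $ i)"
  have U': "U' \<in> carrier_mat m (Suc k)" by (simp add: U'_def)
  have cU': "col U' j = col U j" if "j < k" for j
    using Suc.prems(1) that by (intro eq_vecI) (auto simp: U'_def)
  have cU'k: "col U' k = u" using u by (intro eq_vecI) (auto simp: U'_def)
  have "ctranspose U' * P * U' = 1\<^sub>m (Suc k)"
  proof (rule gram_eqI[OF Pc U'])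
    fix i j assume "i < Suc k" "j < Suc k"
    then show "wip P (col U' i) (col U' j) = 1\<^sub>m (Suc k) $$ (i, j)"
      by (cases "i = k"; cases "j = k") (auto simp: cU' cU'k u(2) Uu uU UU)
  qed simp
  moreover have "l = m - Suc k" using Suc.hyps(2) by simp
  ultimately obtain W where "W \<in> carrier_mat m m" "ctranspose W * P * W = 1\<^sub>m m"
    "\<forall>j<Suc k. col W j = col U' j"
    using Suc.hyps(1)[of "Suc k" U'] U' by blast
  then show ?case using cU' less_Suc_eq by auto
qed

text \<open>The empty system, a matrix without columns, is extended.\<close>

lemma qmat_posdef_orthonormal_basis:
  assumes "qmat_posdef n P"
  shows "\<exists>W \<in> carrier_mat n n. ctranspose W * P * W = 1\<^sub>m n"
  using orthonormal_extend[OF assms, of "0\<^sub>m n 0" 0] qmat_posdefD[OF assms]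
  by (force intro: eq_matI)

text \<open>The left inverse \<open>W^* P\<close> of \<open>W\<close> is also a right inverse, and
  this exhibits \<open>W W^*\<close> as the inverse of \<open>P\<close>. Invertibility of a positive
  definite matrix and the Hermitian symmetry of its inverse are both read off from here.\<close>

lemma orthonormal_basis_inverse:
  assumes P: "P \<in> carrier_mat n n" and W: "W \<in> carrier_mat n n"
    and orth: "ctranspose W * P * W = 1\<^sub>m n"
  shows "W * (ctranspose W * P) = 1\<^sub>m n" "P * (W * ctranspose W) = 1\<^sub>m n"
    "W * ctranspose W * P = 1\<^sub>m n" "qmat_inv P = W * ctranspose W"
proof -
  have WP: "ctranspose W * P \<in> carrier_mat n n"
    using P W by (intro mult_carrier_mat[of _ n n]) auto
  show 1: "W * (ctranspose W * P) = 1\<^sub>m n"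
    by (rule mat_left_inverse_imp_right_inverse[OF WP W orth])
  then show 2: "W * ctranspose W * P = 1\<^sub>m n"
    using P W by (simp add: assoc_mult_mat[of W n n "ctranspose W" n P n])
  show 3: "P * (W * ctranspose W) = 1\<^sub>m n"
    using mat_left_inverse_imp_right_inverse[of "W * ctranspose W" n P] 2 P W by auto
  show "qmat_inv P = W * ctranspose W"
    using qmat_inv_eq[OF P _ 3] W by auto
qed

section \<open>The spectral theorem for Hermitian quaternion matrices\<close>

text \<open>The pair \<open>(a, b)\<close> of complex numbers stands for $a + j b$; under this identification
  $\mathbb{H}^n$ becomes the complex space $\mathbb{C}^{2n}$, with scalars acting on the right.\<close>

definition quat_of :: "complex \<Rightarrow> complex \<Rightarrow> quat" where
  "quat_of a b = Quat (Re a) (Im a) (Re b) (- Im b)"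

definition quat_fst :: "quat \<Rightarrow> complex" where "quat_fst q = Complex (qRe q) (qI q)"
definition quat_snd :: "quat \<Rightarrow> complex" where "quat_snd q = Complex (qJ q) (- qK q)"

lemma quat_of_add: "quat_of a b + quat_of c d = quat_of (a + c) (b + d)"
  by (simp add: quat_of_def plus_quat_def)

lemma quat_of_sum: "(\<Sum>i\<in>S. quat_of (f i) (g i)) = quat_of (sum f S) (sum g S)"
  by (induction S rule: infinite_finite_induct)
    (simp_all add: quat_of_add, simp_all add: quat_of_def zero_quat_def)

lemma quat_of_eq_0_iff: "quat_of a b = 0 \<longleftrightarrow> a = 0 \<and> b = 0"
  by (auto simp: quat_of_def zero_quat_def complex_eq_iff)

text \<open>With \<open>h = h1 + j h2\<close>, the rule \<open>c j = j cnj c\<close> for complex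
  \<open>c\<close> moves every \<open>j\<close> to the left; the result is complex linear in the
  pair \<open>(a, b)\<close>.\<close>

lemma mult_quat_of:
  "h * quat_of a b = quat_of (quat_fst h * a - cnj (quat_snd h) * b) (quat_snd h * a + cnj (quat_fst h) * b)"
  by (simp add: quat_of_def quat_fst_def quat_snd_def times_quat_def algebra_simps)

lemma quat_of_mult_complex: "quat_of a b * quat_of z 0 = quat_of (z * a) (z * b)"
  by (simp add: quat_of_def times_quat_def algebra_simps)

text \<open>The complex matrix of left multiplication by \<open>H\<close>: coordinates below
  \<open>n\<close> hold the first components, those from \<open>n\<close> on the second, and the
  four blocks are the coefficients in \<open>mult_quat_of\<close>.\<close>

definition complex_adjoint :: "nat \<Rightarrow> quat mat \<Rightarrow> complex mat" where
  "complex_adjoint n H = mat (n + n) (n + n) (\<lambda>(i, j).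
     if i < n then if j < n then quat_fst (H $$ (i, j)) else - cnj (quat_snd (H $$ (i, j - n)))
     else if j < n then quat_snd (H $$ (i - n, j)) else cnj (quat_fst (H $$ (i - n, j - n))))"

lemma sum_double:
  fixes f :: "nat \<Rightarrow> 'a::comm_monoid_add"
  shows "(\<Sum>j = 0..<n + n. f j) = (\<Sum>j<n. f j) + (\<Sum>j<n. f (j + n))"
  using sum.atLeastLessThan_concat[of 0 n "n + n" f] sum.shift_bounds_nat_ivl[of f 0 n n]
  by (simp add: lessThan_atLeast0)

text \<open>For \<open>n > 0\<close> the complex matrix has an eigenvalue \<open>z\<close>. Since
  complex scalars act on the right, its eigenvector is a quaternion column \<open>x\<close> with
  \<open>H x = x z\<close>, where \<open>quat_of z 0\<close> is \<open>z\<close> read as a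
  quaternion.\<close>

lemma exists_right_eigenvector:
  assumes H: "H \<in> carrier_mat n n" and n: "0 < n"
  shows "\<exists>x q. x \<in> carrier_vec n \<and> x \<noteq> 0\<^sub>v n \<and> H *\<^sub>v x = vec_smult_right x q"
proof -
  let ?C = "complex_adjoint n H"
  have C: "?C \<in> carrier_mat (n + n) (n + n)" by (simp add: complex_adjoint_def)
  then obtain z where "eigenvalue ?C z"
    using spectrum_non_empty[OF C] n by (auto simp: spectrum_def)
  then obtain v where v: "v \<in> carrier_vec (n + n)" "v \<noteq> 0\<^sub>v (n + n)" "?C *\<^sub>v v = z \<cdot>\<^sub>v v"
    using C by (auto simp: eigenvalue_def eigenvector_def)
  define x where "x = vec n (\<lambda>i. quat_of (v $ i) (v $ (i + n)))"
  have x: "x \<in> carrier_vec n" by (simp add: x_def)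
  have "x \<noteq> 0\<^sub>v n"
  proof
    assume "x = 0\<^sub>v n"
    then have 0: "v $ i = 0" "v $ (i + n) = 0" if "i < n" for i
      using that by (auto simp: x_def vec_eq_iff quat_of_eq_0_iff)
    have "v $ i = 0" if "i < n + n" for i
      using 0(1)[of i] 0(2)[of "i - n"] that by (cases "i < n") auto
    then show False using v by (auto simp: vec_eq_iff)
  qed
  moreover have "H *\<^sub>v x = vec_smult_right x (quat_of z 0)"
  proof (rule eq_vecI)
    fix i assume "i < dim_vec (vec_smult_right x (quat_of z 0))"
    then have i: "i < n" using x by simp
    have Cv: "(\<Sum>j = 0..<n + n. ?C $$ (l, j) * v $ j) = z * v $ l" if "l < n + n" for l
    proof -
      have "(?C *\<^sub>v v) $ l = (\<Sum>j = 0..<n + n. ?C $$ (l, j) * v $ j)"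
        using C v(1) that by (auto simp: scalar_prod_def)
      then show ?thesis using v that by simp
    qed
    have fst: "(\<Sum>j<n. quat_fst (H $$ (i, j)) * v $ j - cnj (quat_snd (H $$ (i, j))) * v $ (j + n)) = z * v $ i"
      using Cv[of i] i by (simp add: sum_double complex_adjoint_def sum.distrib sum_subtractf sum_negf)
    have snd: "(\<Sum>j<n. quat_snd (H $$ (i, j)) * v $ j + cnj (quat_fst (H $$ (i, j))) * v $ (j + n)) = z * v $ (i + n)"
      using Cv[of "i + n"] i by (simp add: sum_double complex_adjoint_def sum.distrib sum_subtractf sum_negf)
    have "(H *\<^sub>v x) $ i = (\<Sum>j<n. H $$ (i, j) * quat_of (v $ j) (v $ (j + n)))"
      using H i by (simp add: scalar_prod_def x_def lessThan_atLeast0)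
    also have "\<dots> = quat_of (z * v $ i) (z * v $ (i + n))"
      by (simp only: mult_quat_of quat_of_sum fst snd)
    also have "\<dots> = vec_smult_right x (quat_of z 0) $ i"
      using i by (simp add: x_def quat_of_mult_complex)
    finally show "(H *\<^sub>v x) $ i = vec_smult_right x (quat_of z 0) $ i" .
  qed (use H x in auto)
  ultimately show ?thesis using x by blast
qed

text \<open>For a right eigenvector, \<open>x^* H x = x^* x q\<close> is fixed by conjugation while
  \<open>x^* x\<close> is a positive real, so \<open>q\<close> is real. Rescaling by a real number
  keeps the eigenvalue because real scalars commute with everything.\<close>

lemma hermitian_unit_eigenvector:
  assumes H: "qmat_hermitian n H" and n: "0 < n"
  shows "\<exists>x d. x \<in> carrier_vec n \<and> wip (1\<^sub>m n) x x = 1 \<and> H *\<^sub>v x = vec_smult_right x (of_real d)"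
proof -
  have Hc: "H \<in> carrier_mat n n" using H by (simp add: qmat_hermitian_def)
  obtain x q where x: "x \<in> carrier_vec n" "x \<noteq> 0\<^sub>v n" "H *\<^sub>v x = vec_smult_right x q"
    using exists_right_eigenvector[OF Hc n] by blast
  obtain t where t: "t > 0" "wip (1\<^sub>m n) x x = of_real t"
    using qmat_posdef_wip[OF qmat_posdef_one x(1,2)] by blast
  have "wip H x x = wip (1\<^sub>m n) x (vec_smult_right x q)"
    using x by (simp add: wip_def)
  also have "\<dots> = of_real t * q" using x t by (simp add: wip_smult_right[of _ n])
  finally have "quat_cnj (of_real t * q) = of_real t * q"
    using wip_cnj[OF H x(1,1)] by simp
  then have "of_real t * quat_cnj q = of_real t * q"
    by (simp add: quat_cnj_mult quat_of_real_commute)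
  then have q: "q = of_real (qRe q)" using t by (simp add: quat_cnj_eq_self_iff)
  obtain s where s: "wip (1\<^sub>m n) (vec_smult_right x (of_real s)) (vec_smult_right x (of_real s)) = 1"
    using wip_normalize[OF qmat_posdef_one x(1,2)] by blast
  have "H *\<^sub>v vec_smult_right x (of_real s) = vec_smult_right (vec_smult_right x (of_real s)) (of_real (qRe q))"
    unfolding mult_mat_vec_smult_right[OF Hc x(1)] x(3)
    by (subst q, intro eq_vecI) (simp_all add: mult.assoc quat_of_real_commute[of s])
  then show ?thesis using s x(1) by (meson vec_smult_right_carrier)
qed

lemma hermitian_gram:
  assumes "qmat_hermitian m H" "U \<in> carrier_mat m k"
  shows "qmat_hermitian k (ctranspose U * H * U)"
proof -
  have H: "H \<in> carrier_mat m m" "ctranspose H = H" using assms by (auto simp: qmat_hermitian_def)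
  have "ctranspose (ctranspose U * H * U) = ctranspose U * (H * U)"
    using H assms(2) by (simp add: ctranspose_mult mat_mult_assoc)
  also have "\<dots> = ctranspose U * H * U" using H assms(2) by (simp add: mat_mult_assoc)
  finally show ?thesis using H assms by (auto simp: qmat_hermitian_def intro!: carrier_matI)
qed

lemma gram_compose:
  assumes "P \<in> carrier_mat m m" "U \<in> carrier_mat m k" "Q \<in> carrier_mat k l"
  shows "ctranspose (U * Q) * P * (U * Q) = ctranspose Q * (ctranspose U * P * U) * Q"
  using carrier_matD[OF assms(1)] carrier_matD[OF assms(2)] carrier_matD[OF assms(3)]
  by (simp add: ctranspose_mult mat_mult_assoc del: assoc_mult_mat)

text \<open>Deflation: in an orthonormal basis beginning with a unit eigenvector, the matrix has
  \<open>d0\<close> in the corner and zeros below it, and Hermitian symmetry clears the first row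
  too. What remains is a Hermitian block of size \<open>n\<close>.\<close>

lemma spectral_theorem:
  "qmat_hermitian n H \<Longrightarrow>
    \<exists>Q d. Q \<in> carrier_mat n n \<and> ctranspose Q * Q = 1\<^sub>m n \<and> ctranspose Q * H * Q = rdiag n n d"
proof (induction n arbitrary: H)
  case 0
  show ?case
    by (rule exI[of _ "1\<^sub>m 0"], rule exI[of _ "\<lambda>_. 0"])
      (use 0 in \<open>auto simp: qmat_hermitian_def intro!: eq_matI\<close>)
next
  case (Suc n)
  have H: "H \<in> carrier_mat (Suc n) (Suc n)" using Suc.prems by (simp add: qmat_hermitian_def)
  have one: "1\<^sub>m (Suc n) \<in> carrier_mat (Suc n) (Suc n)" by simp
  obtain x d0 where x: "x \<in> carrier_vec (Suc n)" "wip (1\<^sub>m (Suc n)) x x = 1"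
    "H *\<^sub>v x = vec_smult_right x (of_real d0)"
    using hermitian_unit_eigenvector[OF Suc.prems] by auto
  have x1: "mat_of_cols (Suc n) [x] \<in> carrier_mat (Suc n) 1" by (simp add: mat_of_cols_def)
  have c0: "col (mat_of_cols (Suc n) [x]) 0 = x" using x(1) by simp
  have "ctranspose (mat_of_cols (Suc n) [x]) * 1\<^sub>m (Suc n) * mat_of_cols (Suc n) [x] = 1\<^sub>m 1"
    by (rule gram_eqI[OF one x1]) (use x c0 in auto)
  then obtain U where U: "U \<in> carrier_mat (Suc n) (Suc n)"
    "ctranspose U * 1\<^sub>m (Suc n) * U = 1\<^sub>m (Suc n)" "col U 0 = x"
    using orthonormal_extend[OF qmat_posdef_one x1] c0 by auto
  define G where "G = ctranspose U * H * U"
  have Gh: "qmat_hermitian (Suc n) G" unfolding G_def by (rule hermitian_gram[OF Suc.prems U(1)])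
  then have Gc: "G \<in> carrier_mat (Suc n) (Suc n)" "ctranspose G = G"
    by (auto simp: qmat_hermitian_def)
  have Gi0: "G $$ (i, 0) = (if i = 0 then of_real d0 else 0)" if "i < Suc n" for i
  proof -
    have ci: "col U i \<in> carrier_vec (Suc n)" using U(1) that by auto
    have "G $$ (i, 0) = wip H (col U i) x"
      unfolding G_def using gram_index[OF H U(1) that, of 0] U(3) by simp
    also have "\<dots> = wip (1\<^sub>m (Suc n)) (col U i) (vec_smult_right x (of_real d0))"
      using x by (simp add: wip_def)
    also have "\<dots> = wip (1\<^sub>m (Suc n)) (col U i) (col U 0) * of_real d0"
      using ci x U(3) by (simp add: wip_smult_right[of _ "Suc n"])
    also have "wip (1\<^sub>m (Suc n)) (col U i) (col U 0) = 1\<^sub>m (Suc n) $$ (i, 0)"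
      using gram_index[OF one U(1) that, of 0] U(2) by simp
    finally show ?thesis using that by simp
  qed
  have G0i: "G $$ (0, i) = (if i = 0 then of_real d0 else 0)" if "i < Suc n" for i
    using ctranspose_index[of 0 G i] Gc Gi0[OF that] that by (auto split: if_splits)
  define H' where "H' = mat n n (\<lambda>(i, j). G $$ (Suc i, Suc j))"
  define D0 where "D0 = rdiag 1 1 (\<lambda>_. d0)"
  have c: "H' \<in> carrier_mat n n" "D0 \<in> carrier_mat 1 1" by (simp_all add: H'_def D0_def)
  have G: "G = four_block_mat D0 (0\<^sub>m 1 n) (0\<^sub>m n 1) H'"
    using Gc Gi0 G0i by (intro eq_matI) (auto simp: H'_def D0_def)
  have "ctranspose H' = H'"
  proof (intro eq_matI)
    fix i j assume "i < dim_row H'" "j < dim_col H'"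
    then show "ctranspose H' $$ (i, j) = H' $$ (i, j)"
      using ctranspose_index[of "Suc i" G "Suc j"] Gc by (simp add: H'_def)
  qed (use c in auto)
  then obtain Q' d' where Q': "Q' \<in> carrier_mat n n" "ctranspose Q' * Q' = 1\<^sub>m n"
    "ctranspose Q' * H' * Q' = rdiag n n d'"
    using Suc.IH[of H'] c by (auto simp: qmat_hermitian_def)
  define B where "B = four_block_mat (1\<^sub>m 1) (0\<^sub>m 1 n) (0\<^sub>m n 1) Q'"
  have B: "B \<in> carrier_mat (Suc n) (Suc n)" using Q' by (auto simp: B_def)
  have B': "ctranspose B = four_block_mat (1\<^sub>m 1) (0\<^sub>m 1 n) (0\<^sub>m n 1) (ctranspose Q')"
    using Q' by (intro eq_matI) (auto simp: B_def)
  note mult_blocks = mult_four_block_mat[where ?nr1.0 = 1 and ?n1.0 = 1 and ?n2.0 = n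
    and ?nr2.0 = n and ?nc1.0 = 1 and ?nc2.0 = n]
  have BB: "ctranspose B * B = 1\<^sub>m (Suc n)"
    unfolding B' unfolding B_def
    by (subst mult_blocks)
      (use Q' in \<open>auto intro!: eq_matI\<close>)
  have BG: "ctranspose B * G = four_block_mat D0 (0\<^sub>m 1 n) (0\<^sub>m n 1) (ctranspose Q' * H')"
    unfolding B' G
    by (subst mult_blocks)
      (use Q' c in auto)
  have "ctranspose B * G * B = four_block_mat D0 (0\<^sub>m 1 n) (0\<^sub>m n 1) (ctranspose Q' * H' * Q')"
    unfolding BG unfolding B_def
    by (subst mult_blocks)
      (use Q' c in auto)
  also have "\<dots> = rdiag (Suc n) (Suc n) (case_nat d0 d')"
    unfolding Q'(3) D0_def by (intro eq_matI) (auto split: nat.split)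
  finally have BGB: "ctranspose B * G * B = rdiag (Suc n) (Suc n) (case_nat d0 d')" .
  have "ctranspose (U * B) * 1\<^sub>m (Suc n) * (U * B) = 1\<^sub>m (Suc n)"
    using gram_compose[OF one U(1) B] U(2) B BB by simp
  then have "ctranspose (U * B) * (U * B) = 1\<^sub>m (Suc n)" using U B by simp
  moreover have "ctranspose (U * B) * H * (U * B) = rdiag (Suc n) (Suc n) (case_nat d0 d')"
    using gram_compose[OF H U(1) B] BGB by (simp add: G_def)
  moreover have "U * B \<in> carrier_mat (Suc n) (Suc n)" using U B by simp
  ultimately show ?case by blast
qed

lemma exists_sorting_permutation:
  fixes d :: "nat \<Rightarrow> real"
  shows "\<exists>p. bij_betw p {..<n} {..<n} \<and> (\<forall>i j. i \<le> j \<and> j < n \<longrightarrow> d (p j) \<le> d (p i))"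
proof -
  define xs where "xs = sort_key (\<lambda>i. - d i) [0..<n]"
  have xs: "length xs = n" "distinct xs" "set xs = {..<n}"
    by (auto simp: xs_def)
  have "sorted (map (\<lambda>i. - d i) xs)" by (simp add: xs_def)
  then have "d (xs ! j) \<le> d (xs ! i)" if "i \<le> j" "j < n" for i j
    using sorted_nth_mono[of "map (\<lambda>i. - d i) xs" i j] that xs(1) by simp
  moreover have "bij_betw ((!) xs) {..<n} {..<n}"
    by (rule bij_betw_nth) (simp_all only: xs)
  ultimately show ?thesis by blast
qed

text \<open>Permuting the columns of \<open>Q\<close> permutes the diagonal. The order is required
  of the singular values, and it also makes the positive diagonal entries an initial
  segment.\<close>

lemma spectral_theorem_sorted:
  assumes "qmat_hermitian n H"
  shows "\<exists>Q d. Q \<in> carrier_mat n n \<and> ctranspose Q * Q = 1\<^sub>m n \<and>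
    ctranspose Q * H * Q = rdiag n n d \<and> (\<forall>i j. i \<le> j \<and> j < n \<longrightarrow> d j \<le> d i)"
proof -
  have H: "H \<in> carrier_mat n n" using assms by (simp add: qmat_hermitian_def)
  have one: "1\<^sub>m n \<in> carrier_mat n n" by simp
  obtain Q d where Q: "Q \<in> carrier_mat n n" "ctranspose Q * Q = 1\<^sub>m n"
    "ctranspose Q * H * Q = rdiag n n d"
    using spectral_theorem[OF assms] by blast
  obtain p where p: "bij_betw p {..<n} {..<n}" "\<forall>i j. i \<le> j \<and> j < n \<longrightarrow> d (p j) \<le> d (p i)"
    using exists_sorting_permutation by blast
  have pn: "p i < n" if "i < n" for i using bij_betwE[OF p(1)] that by auto
  have pinj: "p i = p j \<longleftrightarrow> i = j" if "i < n" "j < n" for i j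
    using bij_betw_imp_inj_on[OF p(1)] that by (auto simp: inj_on_def)
  define Q' where "Q' = mat n n (\<lambda>(i, j). Q $$ (i, p j))"
  have Q': "Q' \<in> carrier_mat n n" by (simp add: Q'_def)
  have cQ': "col Q' j = col Q (p j)" if "j < n" for j
    using Q(1) that pn[OF that] by (intro eq_vecI) (auto simp: Q'_def)
  have "ctranspose Q' * 1\<^sub>m n * Q' = 1\<^sub>m n"
  proof (rule gram_eqI[OF one Q'])
    fix i j assume "i < n" "j < n"
    then show "wip (1\<^sub>m n) (col Q' i) (col Q' j) = 1\<^sub>m n $$ (i, j)"
      using gram_index[OF one Q(1) pn pn, of i j] Q by (simp add: cQ' pn pinj)
  qed simp
  then have "ctranspose Q' * Q' = 1\<^sub>m n" using Q' by simp
  moreover have "ctranspose Q' * H * Q' = rdiag n n (\<lambda>i. d (p i))"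
  proof (rule gram_eqI[OF H Q'])
    fix i j assume "i < n" "j < n"
    then show "wip H (col Q' i) (col Q' j) = rdiag n n (\<lambda>i. d (p i)) $$ (i, j)"
      using gram_index[OF H Q(1) pn pn, of i j] Q by (simp add: cQ' pn pinj)
  qed simp
  ultimately show ?thesis using Q' p(2) by blast
qed

section \<open>Dimensions of eigenspaces and rank\<close>

text \<open>Both the rank and the eigenvalue multiplicities are dimensions of such images of
  coordinate subspaces. More than \<open>card I\<close> vectors are dependent because their
  coordinates give only \<open>card I\<close> equations for the coefficients; the columns of
  \<open>P\<close> with index in \<open>I\<close> attain the bound.\<close>

lemma right_dim_coordinate_image:
  assumes P: "P \<in> carrier_mat n n" and Q: "Q \<in> carrier_mat n n" and QP: "Q * P = 1\<^sub>m n"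
    and I: "I \<subseteq> {..<n}"
  shows "right_dim n {P *\<^sub>v y |y. y \<in> carrier_vec n \<and> (\<forall>i<n. i \<notin> I \<longrightarrow> y $ i = 0)} = card I"
    (is "right_dim n ?S = _")
proof -
  have finI: "finite I" using I finite_subset by blast
  have le: "length vs \<le> card I" if vs: "set vs \<subseteq> ?S" "right_indep n vs" for vs
  proof (rule ccontr)
    assume "\<not> length vs \<le> card I"
    then have less: "card I < length vs" by simp
    have "\<exists>y. vs ! j = P *\<^sub>v y \<and> y \<in> carrier_vec n \<and> (\<forall>i<n. i \<notin> I \<longrightarrow> y $ i = 0)"
      if "j < length vs" for j
      using subsetD[OF vs(1) nth_mem[OF that]] by blast
    then obtain y where y: "\<And>j. j < length vs \<Longrightarrow> vs ! j = P *\<^sub>v y j"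
      "\<And>j. j < length vs \<Longrightarrow> y j \<in> carrier_vec n"
      "\<And>i j. j < length vs \<Longrightarrow> i < n \<Longrightarrow> i \<notin> I \<Longrightarrow> y j $ i = 0"
      by metis
    obtain c where c: "\<exists>j\<in>{..<length vs}. c j \<noteq> 0"
      "\<forall>i\<in>I. (\<Sum>j<length vs. y j $ i * c j) = 0"
      using exists_nontrivial_solution[OF finI finite_lessThan, of "length vs" "\<lambda>i j. y j $ i"] less
      by auto
    have yc: "(\<Sum>j<length vs. y j $ i * c j) = 0" if "i < n" for i
      using c(2) y(3) that by (cases "i \<in> I") auto
    have "mat_of_cols n vs *\<^sub>v vec (length vs) c = 0\<^sub>v n"
    proof (rule eq_vecI)
      fix l assume "l < dim_vec (0\<^sub>v n :: quat vec)"
      then have l: "l < n" by simp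
      have "(mat_of_cols n vs *\<^sub>v vec (length vs) c) $ l = (\<Sum>j<length vs. (vs ! j) $ l * c j)"
        using l by (auto simp: scalar_prod_def mat_of_cols_def lessThan_atLeast0)
      also have "\<dots> = (\<Sum>j<length vs. \<Sum>i<n. P $$ (l, i) * (y j $ i * c j))"
      proof (intro sum.cong refl)
        fix j assume "j \<in> {..<length vs}"
        then have j: "j < length vs" by simp
        show "(vs ! j) $ l * c j = (\<Sum>i<n. P $$ (l, i) * (y j $ i * c j))"
          using P l y(2)[OF j] unfolding y(1)[OF j]
          by (auto simp: scalar_prod_def sum_distrib_right mult.assoc lessThan_atLeast0)
      qed
      also have "\<dots> = (\<Sum>i<n. P $$ (l, i) * (\<Sum>j<length vs. y j $ i * c j))"
        by (subst sum.swap) (simp add: sum_distrib_left)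
      also have "\<dots> = 0" using yc by simp
      finally show "(mat_of_cols n vs *\<^sub>v vec (length vs) c) $ l = 0\<^sub>v n $ l" using l by simp
    qed (simp add: mat_of_cols_def)
    then have "vec (length vs) c = 0\<^sub>v (length vs)"
      using vs(2) by (simp add: right_indep_def)
    then show False using c(1) by (auto simp: vec_eq_iff)
  qed
  define xs where "xs = sorted_list_of_set I"
  have xs: "set xs = I" "distinct xs" "length xs = card I" using finI by (simp_all add: xs_def)
  have xsn: "xs ! j < n" if "j < card I" for j using xs I that nth_mem by fastforce
  define vs where "vs = map (col P) xs"
  have "set vs \<subseteq> ?S"
  proof
    fix v assume "v \<in> set vs"
    then obtain i where i: "i \<in> I" "i < n" "v = col P i" using xs I by (auto simp: vs_def)
    have "v = P *\<^sub>v unit_vec n i" using P i by (intro eq_vecI) auto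
    then show "v \<in> ?S" using i by (intro CollectI exI[of _ "unit_vec n i"]) auto
  qed
  moreover have "right_indep n vs"
    unfolding right_indep_def
  proof (intro conjI ballI impI)
    show "set vs \<subseteq> carrier_vec n" using P by (auto simp: vs_def)
    fix c assume c: "c \<in> carrier_vec (length vs)" and 0: "mat_of_cols n vs *\<^sub>v c = 0\<^sub>v n"
    have mc: "mat_of_cols n vs \<in> carrier_mat n (card I)" using xs by (simp add: mat_of_cols_def vs_def)
    define R where "R = Q * mat_of_cols n vs"
    have R: "R \<in> carrier_mat n (card I)" using Q mc by (simp add: R_def)
    have cc: "c \<in> carrier_vec (card I)" using c xs by (simp add: vs_def)
    have "R *\<^sub>v c = Q *\<^sub>v (mat_of_cols n vs *\<^sub>v c)"
      unfolding R_def using Q mc cc by (intro assoc_mult_mat_vec) auto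
    also have "\<dots> = 0\<^sub>v n" unfolding 0 using Q by (rule mult_mat_zero_vec)
    finally have z: "R *\<^sub>v c = 0\<^sub>v n" .
    \<comment> \<open>\<open>Q\<close> turns the chosen columns of \<open>P\<close> into unit
      vectors, so row \<open>xs ! l\<close> of \<open>R\<close> isolates the coefficient
      \<open>c $ l\<close>.\<close>
    have E: "R $$ (xs ! l, j) = (if j = l then 1 else 0)"
      if "l < card I" "j < card I" for l j
    proof -
      have "col (mat_of_cols n vs) j = col P (xs ! j)"
        using that xs P by (subst col_mat_of_cols) (auto simp: vs_def)
      then have "R $$ (xs ! l, j) = (Q * P) $$ (xs ! l, xs ! j)"
        using that Q P carrier_matD[OF mc] xsn by (simp add: R_def del: mat_of_cols_carrier)
      then show ?thesis unfolding QP using xsn that xs nth_eq_iff_index_eq[of xs] by auto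
    qed
    have "c $ l = 0" if l: "l < card I" for l
    proof -
      have "(R *\<^sub>v c) $ (xs ! l)
          = (\<Sum>j = 0..<card I. R $$ (xs ! l, j) * c $ j)"
        using R cc xsn[OF l] by (auto simp: scalar_prod_def)
      also have "\<dots> = (\<Sum>j = 0..<card I. if j = l then c $ l else 0)"
        using E l by (intro sum.cong) auto
      also have "\<dots> = c $ l" using l by (subst sum.delta) auto
      finally show ?thesis unfolding z using xsn[OF l] by simp
    qed
    then show "c = 0\<^sub>v (length vs)" using c xs by (intro eq_vecI) (auto simp: vs_def)
  qed
  ultimately have mem: "card I \<in> {length vs |vs. set vs \<subseteq> ?S \<and> right_indep n vs}"
    using xs(3) by (intro CollectI exI[of _ vs]) (simp add: vs_def)
  show ?thesis unfolding right_dim_def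
  proof (rule Max_eqI)
    show "finite {length vs |vs. set vs \<subseteq> ?S \<and> right_indep n vs}"
      by (rule finite_subset[of _ "{..card I}"]) (use le in auto)
    show "k \<le> card I" if "k \<in> {length vs |vs. set vs \<subseteq> ?S \<and> right_indep n vs}" for k
      using that le by blast
  qed (fact mem)
qed

text \<open>In the coordinates \<open>y = Q x\<close> the eigenvalue equation reads
  \<open>d i * y i = y i * q\<close>. As \<open>d i\<close> is real it moves past
  \<open>y i\<close>, and a nonzero \<open>y i\<close> cancels; a nonreal diagonal entry would
  determine \<open>q\<close> only up to conjugation.\<close>

lemma diagonalized_right_eigenvalue_iff:
  assumes P: "P \<in> carrier_mat n n" and Q: "Q \<in> carrier_mat n n"
    and QP: "Q * P = 1\<^sub>m n" and PQ: "P * Q = 1\<^sub>m n"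
  shows "right_eigenvalue (P * rdiag n n d * Q) q \<longleftrightarrow> (\<exists>i<n. q = of_real (d i))"
proof -
  let ?D = "rdiag n n d" and ?B = "P * rdiag n n d * Q"
  have PD: "P * ?D \<in> carrier_mat n n" using P by auto
  have B: "?B \<in> carrier_mat n n" using PD Q by auto
  have Bx: "?B *\<^sub>v x = P *\<^sub>v (?D *\<^sub>v (Q *\<^sub>v x))" if "x \<in> carrier_vec n" for x
    using that P Q PD by (simp add: assoc_mult_mat_vec[of _ n n _ n])
  have QPx: "Q *\<^sub>v (P *\<^sub>v x) = x" if "x \<in> carrier_vec n" for x
    using that P Q QP by (simp add: assoc_mult_mat_vec[of _ n n _ n, symmetric] del: assoc_mult_mat_vec)
  have PQx: "P *\<^sub>v (Q *\<^sub>v x) = x" if "x \<in> carrier_vec n" for x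
    using that P Q PQ by (simp add: assoc_mult_mat_vec[of _ n n _ n, symmetric] del: assoc_mult_mat_vec)
  show ?thesis
  proof
    assume "right_eigenvalue ?B q"
    then obtain x where x: "x \<in> carrier_vec n" "x \<noteq> 0\<^sub>v n" "?B *\<^sub>v x = vec_smult_right x q"
      using carrier_matD[OF B] unfolding right_eigenvalue_def by auto
    define y where "y = Q *\<^sub>v x"
    have y: "y \<in> carrier_vec n" using Q x by (simp add: y_def)
    have "y \<noteq> 0\<^sub>v n" using PQx[OF x(1)] x(2) mult_mat_zero_vec[OF P] by (auto simp: y_def)
    then obtain i where i: "i < n" "y $ i \<noteq> 0" using y by (auto simp: vec_eq_iff)
    have "?D *\<^sub>v y = Q *\<^sub>v (?B *\<^sub>v x)"
      using Bx[OF x(1)] QPx[of "?D *\<^sub>v y"] y by (simp add: y_def mult_mat_vec_carrier[of _ n n])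
    also have "\<dots> = vec_smult_right y q"
      unfolding x(3) y_def using Q x(1) by (rule mult_mat_vec_smult_right)
    finally have "(?D *\<^sub>v y) $ i = vec_smult_right y q $ i" by simp
    then have "of_real (d i) * y $ i = y $ i * q"
      using i y by (simp add: rdiag_mult_vec_index del: index_mult_mat_vec)
    then have "y $ i * of_real (d i) = y $ i * q" by (simp only: quat_of_real_commute)
    then show "\<exists>i<n. q = of_real (d i)" using i by auto
  next
    assume "\<exists>i<n. q = of_real (d i)"
    then obtain i where i: "i < n" "q = of_real (d i)" by blast
    define y :: "quat vec" where "y = unit_vec n i"
    have y: "y \<in> carrier_vec n" by (simp add: y_def)
    have "?D *\<^sub>v y = vec_smult_right y q"
      using i by (intro eq_vecI) (auto simp: rdiag_mult_vec_index y_def simp del: index_mult_mat_vec)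
    then have "?B *\<^sub>v (P *\<^sub>v y) = vec_smult_right (P *\<^sub>v y) q"
      using Bx[of "P *\<^sub>v y"] QPx[OF y] P y mult_mat_vec_smult_right[OF P y, of q]
      by simp
    moreover have "y \<noteq> 0\<^sub>v n" using i by (auto simp: y_def vec_eq_iff)
    then have "P *\<^sub>v y \<noteq> 0\<^sub>v n" using QPx[OF y] mult_mat_zero_vec[OF Q] by auto
    ultimately show "right_eigenvalue ?B q"
      unfolding right_eigenvalue_def using B P y by (intro bexI[of _ "P *\<^sub>v y"]) auto
  qed
qed

lemma similar_mat_power:
  fixes P :: "'a::semiring_1 mat"
  assumes P: "P \<in> carrier_mat n n" and Q: "Q \<in> carrier_mat n n" and D: "D \<in> carrier_mat n n"
    and QP: "Q * P = 1\<^sub>m n" and PQ: "P * Q = 1\<^sub>m n"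
  shows "(P * D * Q) ^\<^sub>m k = P * D ^\<^sub>m k * Q"
proof (induction k)
  case 0
  show ?case using P Q D PQ by simp
next
  case (Suc k)
  have Dk: "D ^\<^sub>m k \<in> carrier_mat n n" using D by simp
  have QPX: "Q * (P * X) = X" if "X \<in> carrier_mat n n" for X
    using that P Q QP by (simp add: assoc_mult_mat[of Q n n P n X n, symmetric] del: assoc_mult_mat)
  have DQ: "D * Q \<in> carrier_mat n n" using D Q by simp
  have "(P * D * Q) ^\<^sub>m Suc k = P * D ^\<^sub>m k * Q * (P * D * Q)" by (simp only: pow_mat.simps Suc.IH)
  also have "\<dots> = P * D ^\<^sub>m Suc k * Q"
    using carrier_matD[OF P] carrier_matD[OF Q] carrier_matD[OF D] carrier_matD[OF Dk]
    by (simp add: mat_mult_assoc QPX[OF DQ] del: assoc_mult_mat)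
  finally show ?case .
qed

lemma rdiag_power: "rdiag n n d ^\<^sub>m k = rdiag n n (\<lambda>i. d i ^ k)"
  by (induction k) (auto simp: rdiag_one rdiag_mult mult.commute intro!: rdiag_cong)

text \<open>\<open>B - t I\<close> is diagonalized by the same matrices with entries
  \<open>d i - t\<close>, so its \<open>n\<close>-th power kills exactly the columns supported, in
  the coordinates \<open>Q x\<close>, on the indices with \<open>d i = t\<close>.\<close>

lemma diagonalized_real_eigenvalue_mult:
  assumes P: "P \<in> carrier_mat n n" and Q: "Q \<in> carrier_mat n n"
    and QP: "Q * P = 1\<^sub>m n" and PQ: "P * Q = 1\<^sub>m n"
  shows "real_eigenvalue_mult (P * rdiag n n d * Q) t = card {i. i < n \<and> d i = t}"
proof -
  let ?B = "P * rdiag n n d * Q" and ?I = "{i. i < n \<and> d i = t}"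
  let ?E = "rdiag n n (\<lambda>i. (d i - t) ^ n)"
  have B: "?B \<in> carrier_mat n n" using P Q by auto
  have QPx: "Q *\<^sub>v (P *\<^sub>v x) = x" if "x \<in> carrier_vec n" for x
    using that P Q QP by (simp add: assoc_mult_mat_vec[of _ n n _ n, symmetric] del: assoc_mult_mat_vec)
  have PQx: "P *\<^sub>v (Q *\<^sub>v x) = x" if "x \<in> carrier_vec n" for x
    using that P Q PQ by (simp add: assoc_mult_mat_vec[of _ n n _ n, symmetric] del: assoc_mult_mat_vec)
  have "rdiag n n (\<lambda>i. d i - t) = rdiag n n d - of_real t \<cdot>\<^sub>m 1\<^sub>m n"
    by (intro eq_matI) auto
  then have "P * rdiag n n (\<lambda>i. d i - t) * Q = ?B - P * (of_real t \<cdot>\<^sub>m 1\<^sub>m n) * Q"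
    using P Q by (simp add: mult_minus_distrib_mat[of _ n n _ n] minus_mult_distrib_mat[of _ n n _ _ n])
  \<comment> \<open>Only a central scalar passes through \<open>P\<close> like this; here
    \<open>t\<close> is real.\<close>
  also have "P * (of_real t \<cdot>\<^sub>m 1\<^sub>m n) = of_real t \<cdot>\<^sub>m P"
    using P by (intro eq_matI)
      (auto simp: scalar_prod_def quat_of_real_commute if_distrib cong: if_cong)
  also have "of_real t \<cdot>\<^sub>m P * Q = of_real t \<cdot>\<^sub>m (P * Q)"
    using P Q by (intro eq_matI) (auto simp: scalar_prod_def sum_distrib_left mult.assoc)
  finally have "?B - of_real t \<cdot>\<^sub>m 1\<^sub>m n = P * rdiag n n (\<lambda>i. d i - t) * Q" unfolding PQ by simp
  then have pow: "(?B - of_real t \<cdot>\<^sub>m 1\<^sub>m n) ^\<^sub>m n = P * ?E * Q"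
    using similar_mat_power[OF P Q rdiag_carrier QP PQ] by (simp add: rdiag_power)
  have ker: "(P * ?E * Q) *\<^sub>v x = 0\<^sub>v n \<longleftrightarrow> (\<forall>i<n. i \<notin> ?I \<longrightarrow> (Q *\<^sub>v x) $ i = 0)"
    if x: "x \<in> carrier_vec n" for x
  proof -
    have y: "Q *\<^sub>v x \<in> carrier_vec n" using Q x by simp
    have Ey: "?E *\<^sub>v (Q *\<^sub>v x) \<in> carrier_vec n" by (simp add: mult_mat_vec_carrier[of _ n n] y)
    have PE: "P * ?E \<in> carrier_mat n n" using P by auto
    have "(P * ?E * Q) *\<^sub>v x = P *\<^sub>v (?E *\<^sub>v (Q *\<^sub>v x))"
      using x P Q PE by (simp add: assoc_mult_mat_vec[of _ n n _ n])
    then have "(P * ?E * Q) *\<^sub>v x = 0\<^sub>v n \<longleftrightarrow> ?E *\<^sub>v (Q *\<^sub>v x) = 0\<^sub>v n"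
      using QPx[OF Ey] mult_mat_zero_vec[OF P] mult_mat_zero_vec[OF Q] by auto
    also have "\<dots> \<longleftrightarrow> (\<forall>i<n. (?E *\<^sub>v (Q *\<^sub>v x)) $ i = 0)"
      using Ey by (auto simp: vec_eq_iff simp del: index_mult_mat_vec)
    \<comment> \<open>An index \<open>i < n\<close> forces \<open>n > 0\<close>, so
      \<open>(d i - t) ^ n\<close> vanishes exactly when \<open>d i = t\<close>.\<close>
    also have "\<dots> \<longleftrightarrow> (\<forall>i<n. i \<notin> ?I \<longrightarrow> (Q *\<^sub>v x) $ i = 0)"
      using y by (auto simp: rdiag_mult_vec_index simp del: index_mult_mat_vec)
    finally show ?thesis .
  qed
  have "{x \<in> carrier_vec n. (P * ?E * Q) *\<^sub>v x = 0\<^sub>v n} =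
      {P *\<^sub>v y |y. y \<in> carrier_vec n \<and> (\<forall>i<n. i \<notin> ?I \<longrightarrow> y $ i = 0)}" (is "?L = ?R")
  proof (intro equalityI subsetI)
    fix x assume "x \<in> ?L"
    then have "x \<in> carrier_vec n" "\<forall>i<n. i \<notin> ?I \<longrightarrow> (Q *\<^sub>v x) $ i = 0" using ker by blast+
    then show "x \<in> ?R"
      using PQx[of x] Q by (intro CollectI exI[of _ "Q *\<^sub>v x"]) (auto simp del: index_mult_mat_vec)
  next
    fix x assume "x \<in> ?R"
    then obtain y where y: "x = P *\<^sub>v y" "y \<in> carrier_vec n" "\<forall>i<n. i \<notin> ?I \<longrightarrow> y $ i = 0" by blast
    then have x: "x \<in> carrier_vec n" using P by simp
    have "(P * ?E * Q) *\<^sub>v x = 0\<^sub>v n" using ker[OF x] y QPx[OF y(2)] by simp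
    then show "x \<in> ?L" using x by blast
  qed
  moreover have "right_dim n ?R = card ?I"
    by (rule right_dim_coordinate_image[OF P Q QP]) auto
  ultimately show ?thesis
    unfolding real_eigenvalue_mult_def Let_def using carrier_matD[OF B] pow by simp
qed

lemma diagonalized_nonzero_eigenvalues_are:
  assumes "P \<in> carrier_mat n n" "Q \<in> carrier_mat n n" "Q * P = 1\<^sub>m n" "P * Q = 1\<^sub>m n"
    and r: "r \<le> n" and \<tau>: "\<forall>i<r. \<tau> i \<noteq> 0"
  shows "nonzero_eigenvalues_are (P * rdiag n n (\<lambda>i. if i < r then \<tau> i else 0) * Q) r \<tau>"
  unfolding nonzero_eigenvalues_are_def diagonalized_right_eigenvalue_iff[OF assms(1-4)]
    diagonalized_real_eigenvalue_mult[OF assms(1-4)]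
proof (intro conjI allI impI)
  show "{q. q \<noteq> 0 \<and> (\<exists>i<n. q = of_real (if i < r then \<tau> i else 0))} = {of_real (\<tau> i) |i. i < r}"
    using r \<tau> by (auto split: if_splits)
  show "card {i. i < n \<and> (if i < r then \<tau> i else 0) = t} = card {i. i < r \<and> \<tau> i = t}"
    if "t \<noteq> 0" for t
    using r that by (intro arg_cong[where f = card]) auto
qed

text \<open>\<open>Q\<close> is onto by its right inverse, so the range is the image under
  \<open>U\<close> of the range of the diagonal matrix, which is the coordinate subspace on its
  nonzero entries.\<close>

lemma qmat_rank_rdiag:
  assumes U: "U \<in> carrier_mat m m" "U' \<in> carrier_mat m m" "U' * U = 1\<^sub>m m"
    and Q: "Q \<in> carrier_mat n n" "Q' \<in> carrier_mat n n" "Q * Q' = 1\<^sub>m n"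
  shows "qmat_rank (U * rdiag m n f * Q) = card {i. i < m \<and> i < n \<and> f i \<noteq> 0}"
proof -
  let ?D = "rdiag m n f" and ?I = "{i. i < m \<and> i < n \<and> f i \<noteq> 0}"
  have UD: "U * ?D \<in> carrier_mat m n" using U by auto
  have Ax: "(U * ?D * Q) *\<^sub>v x = U *\<^sub>v (?D *\<^sub>v (Q *\<^sub>v x))" if "x \<in> carrier_vec n" for x
    using that U Q UD by (simp add: assoc_mult_mat_vec[of _ m n _ n] assoc_mult_mat_vec[of _ m m _ n])
  have "{(U * ?D * Q) *\<^sub>v x |x. x \<in> carrier_vec n} =
    {U *\<^sub>v y |y. y \<in> carrier_vec m \<and> (\<forall>i<m. i \<notin> ?I \<longrightarrow> y $ i = 0)}" (is "?L = ?R")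
  proof (intro equalityI subsetI)
    fix v assume "v \<in> ?L"
    then obtain x where x: "x \<in> carrier_vec n" "v = U *\<^sub>v (?D *\<^sub>v (Q *\<^sub>v x))" using Ax by auto
    have "Q *\<^sub>v x \<in> carrier_vec n" using Q x by simp
    then show "v \<in> ?R"
      using x by (intro CollectI exI[of _ "?D *\<^sub>v (Q *\<^sub>v x)"])
        (auto simp: rdiag_mult_vec_index mult_mat_vec_carrier[of _ m n] simp del: index_mult_mat_vec)
  next
    fix v assume "v \<in> ?R"
    then obtain y where y: "v = U *\<^sub>v y" "y \<in> carrier_vec m" "\<forall>i<m. i \<notin> ?I \<longrightarrow> y $ i = 0" by blast
    define z where "z = vec n (\<lambda>i. if i \<in> ?I then of_real (inverse (f i)) * y $ i else 0)"
    have z: "z \<in> carrier_vec n" by (simp add: z_def)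
    have "?D *\<^sub>v z = y"
    proof (rule eq_vecI)
      fix i assume "i < dim_vec y"
      then have i: "i < m" using y by simp
      show "(?D *\<^sub>v z) $ i = y $ i"
        using y(3) i unfolding rdiag_mult_vec_index[OF z i]
        by (auto simp: z_def mult.assoc[symmetric] simp flip: of_real_mult)
    qed (use y in auto)
    moreover have "Q *\<^sub>v (Q' *\<^sub>v z) = z"
      using Q z by (simp add: assoc_mult_mat_vec[of _ n n _ n, symmetric] del: assoc_mult_mat_vec)
    ultimately have "v = (U * ?D * Q) *\<^sub>v (Q' *\<^sub>v z)" using Ax[of "Q' *\<^sub>v z"] Q z y by simp
    then show "v \<in> ?L" using Q z by (intro CollectI exI[of _ "Q' *\<^sub>v z"]) auto
  qed
  moreover have "right_dim m ?R = card ?I"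
    by (rule right_dim_coordinate_image[OF U]) auto
  ultimately show ?thesis using U Q by (simp add: qmat_rank_def)
qed

section \<open>Weighted singular value decomposition\<close>

lemma posdef_inverse:
  assumes "qmat_posdef n N"
  shows "qmat_inv N \<in> carrier_mat n n" "ctranspose (qmat_inv N) = qmat_inv N"
    "N * qmat_inv N = 1\<^sub>m n" "qmat_inv N * N = 1\<^sub>m n"
proof -
  note N = qmat_posdefD(2)[OF assms]
  obtain W where W: "W \<in> carrier_mat n n" "ctranspose W * N * W = 1\<^sub>m n"
    using qmat_posdef_orthonormal_basis[OF assms] by blast
  note inv = orthonormal_basis_inverse[OF N W]
  show "qmat_inv N \<in> carrier_mat n n" "ctranspose (qmat_inv N) = qmat_inv N"
    "N * qmat_inv N = 1\<^sub>m n" "qmat_inv N * N = 1\<^sub>m n"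
    using inv W by (simp_all add: inv(4) ctranspose_mult)
qed

text \<open>The number \<open>s\<close> comes out of the construction and is not yet tied to the
  rank. Its bound by \<open>m\<close> holds because \<open>s\<close> orthonormal columns of height
  \<open>m\<close> have been produced.\<close>

lemma weighted_svd_exists:
  assumes A: "A \<in> carrier_mat m n" and Mp: "qmat_posdef m M" and Np: "qmat_posdef n N"
  shows "\<exists>s U V \<sigma>. s \<le> m \<and> s \<le> n \<and> is_weighted_svd m n s M N A U V \<sigma>"
proof -
  note M = qmat_posdefD(2,3)[OF Mp] and N = qmat_posdefD(2,3)[OF Np]
  obtain W0 where W0: "W0 \<in> carrier_mat n n" "ctranspose W0 * N * W0 = 1\<^sub>m n"
    using qmat_posdef_orthonormal_basis[OF Np] by blast
  define S0 where "S0 = A * W0"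
  have S0: "S0 \<in> carrier_mat m n" using A W0 by (simp add: S0_def)
  obtain Q d where Q: "Q \<in> carrier_mat n n" "ctranspose Q * Q = 1\<^sub>m n"
    "ctranspose Q * (ctranspose S0 * M * S0) * Q = rdiag n n d" "\<forall>i j. i \<le> j \<and> j < n \<longrightarrow> d j \<le> d i"
    using spectral_theorem_sorted[OF hermitian_gram[OF qmat_posdefD(1)[OF Mp] S0]] by blast
  define W where "W = W0 * Q"
  define S where "S = S0 * Q"
  have W: "W \<in> carrier_mat n n" using W0 Q by (simp add: W_def)
  have WNW: "ctranspose W * N * W = 1\<^sub>m n"
    unfolding W_def gram_compose[OF N(1) W0(1) Q(1)] W0(2) using Q by simp
  have S: "S \<in> carrier_mat m n" using S0 Q by (simp add: S_def)
  have AW: "A * W = S" unfolding S_def S0_def W_def using A W0 Q by simp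
  have SMS: "ctranspose S * M * S = rdiag n n d"
    unfolding S_def using gram_compose[OF M(1) S0 Q(1)] Q(3) by simp
  have cS: "col S i \<in> carrier_vec m" if "i < n" for i using S that by auto
  have wipS: "wip M (col S i) (col S j) = (if i = j then of_real (d i) else 0)" if "i < n" "j < n" for i j
    using gram_index[OF M(1) S that] that unfolding SMS by simp
  \<comment> \<open>\<open>d i\<close> is the squared \<open>M\<close>-length of column
    \<open>i\<close> of \<open>S\<close>: it is nonnegative, and it vanishes only together with the
    column.\<close>
  have d_cases: "d i > 0 \<or> d i = 0 \<and> col S i = 0\<^sub>v m" if i: "i < n" for i
  proof (cases "col S i = 0\<^sub>v m")
    case True
    have "wip M (col S i) (col S i) = 0"
      unfolding True using wip_eq_sum[OF M(1), of "0\<^sub>v m" "0\<^sub>v m"] by simp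
    then show ?thesis using wipS[OF i i] True by simp
  next
    case False
    then show ?thesis using qmat_posdef_wip[OF Mp cS[OF i] False] wipS[OF i i] by auto
  qed
  \<comment> \<open>The first index without positive \<open>d\<close>; the disjunct
    \<open>s = n\<close> provides a value when all are positive. By the decreasing order only zero
    columns follow.\<close>
  define s where "s = (LEAST s. s = n \<or> \<not> d s > 0)"
  have s_n: "s \<le> n" unfolding s_def by (rule Least_le) simp
  have d_pos: "d i > 0" if "i < s" for i using not_less_Least[of i] that unfolding s_def by blast
  have "s = n \<or> \<not> d s > 0" unfolding s_def by (rule LeastI[of _ n]) simp
  then have d_zero: "d i = 0 \<and> col S i = 0\<^sub>v m" if "s \<le> i" "i < n" for i
    using Q(4) d_cases[of i] that by force
  define \<sigma> where "\<sigma> i = sqrt (d i)" for i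
  have \<sigma>_pos: "\<sigma> i > 0" if "i < s" for i using d_pos[OF that] by (simp add: \<sigma>_def)
  have \<sigma>_sq: "\<sigma> i * \<sigma> i = d i" if "i < s" for i using d_pos[OF that] by (simp add: \<sigma>_def)
  \<comment> \<open>Column \<open>j\<close> of \<open>S\<close> has \<open>M\<close>-length
    \<open>\<sigma> j\<close>, whence the factor; only the first \<open>s\<close> columns can be
    normalized.\<close>
  define U0 where "U0 = mat m s (\<lambda>(i, j). S $$ (i, j) * of_real (inverse (\<sigma> j)))"
  have U0: "U0 \<in> carrier_mat m s" by (simp add: U0_def)
  have cU0: "col U0 j = vec_smult_right (col S j) (of_real (inverse (\<sigma> j)))" if "j < s" for j
    using that s_n S by (intro eq_vecI) (auto simp: U0_def)
  have U0_orth: "ctranspose U0 * M * U0 = 1\<^sub>m s"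
  proof (rule gram_eqI[OF M(1) U0])
    fix i j assume ij: "i < s" "j < s"
    have "wip M (col U0 i) (col U0 j) = of_real (inverse (\<sigma> i)) * (wip M (col S i) (col S j) * of_real (inverse (\<sigma> j)))"
      using ij s_n cS M(1) by (simp only: cU0) (simp add: wip_smult_left[of _ m] wip_smult_right[of _ m] mult.assoc
        del: of_real_inverse)
    also have "\<dots> = (if i = j then of_real (inverse (\<sigma> i) * (d i * inverse (\<sigma> i))) else 0)"
      using ij s_n by (simp only: wipS of_real_mult) (auto simp: wipS)
    also have "\<dots> = 1\<^sub>m s $$ (i, j)"
    proof -
      have "inverse (\<sigma> i) * (d i * inverse (\<sigma> i)) = 1"
        using \<sigma>_pos[OF ij(1)] unfolding \<sigma>_sq[OF ij(1), symmetric] by (simp add: field_simps)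
      then show ?thesis using ij by (simp only:) simp
    qed
    finally show "wip M (col U0 i) (col U0 j) = 1\<^sub>m s $$ (i, j)" .
  qed simp
  have s_m: "s \<le> m" by (rule orthonormal_card_le[OF M(1) U0 U0_orth])
  obtain U where U: "U \<in> carrier_mat m m" "ctranspose U * M * U = 1\<^sub>m m" "\<forall>j<s. col U j = col U0 j"
    using orthonormal_extend[OF Mp U0 U0_orth] by blast
  define D where "D = rdiag m n (\<lambda>i. if i < s then \<sigma> i else 0)"
  have D: "D \<in> carrier_mat m n" by (simp add: D_def)
  have UD: "U * D = S"
  proof (rule eq_matI)
    fix i j assume "i < dim_row S" "j < dim_col S"
    then have ij: "i < m" "j < n" using S by auto
    have "(U * D) $$ (i, j) = (\<Sum>l = 0..<m. U $$ (i, l) * D $$ (l, j))"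
      using U D ij by (auto simp: scalar_prod_def)
    also have "\<dots> = (\<Sum>l = 0..<m. if l = j then (if j < s then U $$ (i, j) * of_real (\<sigma> j) else 0) else 0)"
      using ij by (intro sum.cong) (auto simp: D_def)
    also have "\<dots> = (if j < s then U $$ (i, j) * of_real (\<sigma> j) else 0)"
      using s_m by (subst sum.delta) auto
    also have "\<dots> = S $$ (i, j)"
    proof (cases "j < s")
      case True
      have "U $$ (i, j) = col U j $ i" using U(1) ij True s_m by simp
      also have "\<dots> = S $$ (i, j) * of_real (inverse (\<sigma> j))"
        using U(3) True ij by (simp add: U0_def)
      finally have "U $$ (i, j) * of_real (\<sigma> j) = S $$ (i, j) * of_real (inverse (\<sigma> j) * \<sigma> j)"
        by (simp add: mult.assoc)
      then show ?thesis using True \<sigma>_pos[OF True] by simp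
    next
      case False
      then have "col S j $ i = 0" using d_zero[of j] ij by simp
      then show ?thesis using False ij S by simp
    qed
    finally show "(U * D) $$ (i, j) = S $$ (i, j)" .
  qed (use U D S in auto)
  define V where "V = N * W"
  have V: "V \<in> carrier_mat n n" using N W by (simp add: V_def)
  have cV: "ctranspose V = ctranspose W * N" using N W by (simp add: V_def ctranspose_mult)
  note inv = orthonormal_basis_inverse[OF N(1) W WNW]
  have NiV: "qmat_inv N * V = W"
    unfolding V_def using posdef_inverse[OF Np] N(1) W
    by (simp add: assoc_mult_mat[of _ n n N n W n, symmetric] del: assoc_mult_mat)
  have "ctranspose V * qmat_inv N * V = ctranspose V * (qmat_inv N * V)"
    using V posdef_inverse(1)[OF Np] by (intro assoc_mult_mat) auto
  also have "\<dots> = 1\<^sub>m n" unfolding NiV cV by (rule WNW)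
  finally have VV: "ctranspose V * qmat_inv N * V = 1\<^sub>m n" .
  have "A = A * (W * ctranspose V)" unfolding cV inv(1) using A by simp
  also have "\<dots> = A * W * ctranspose V" using A W V by (intro assoc_mult_mat[symmetric]) auto
  finally have "A = U * D * ctranspose V" unfolding AW UD .
  moreover have "\<sigma> j \<le> \<sigma> i" if "i \<le> j" "j < s" for i j
    using Q(4) that s_n by (simp add: \<sigma>_def)
  ultimately have "is_weighted_svd m n s M N A U V \<sigma>"
    unfolding is_weighted_svd_def pad_zero_sigma_mat[OF s_m s_n]
    using U V VV \<sigma>_pos by (auto simp: D_def)
  then show ?thesis using s_m s_n by blast
qed

section \<open>Weighted Moore-Penrose inverse\<close>

text \<open>An idempotent is determined by its range together with self-adjointness, and also by its
  kernel together with self-adjointness.\<close>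

lemma weighted_projection_eq_range:
  assumes M: "M \<in> carrier_mat m m" "ctranspose M = M" "M' \<in> carrier_mat m m" "M' * M = 1\<^sub>m m"
    and P: "P \<in> carrier_mat m m" "Q \<in> carrier_mat m m" "Q * P = P" "P * Q = Q"
    and herm: "ctranspose (M * P) = M * P" "ctranspose (M * Q) = M * Q"
  shows "P = Q"
proof -
  note assoc = mat_mult_assoc carrier_matD[OF M(1)] carrier_matD[OF P(1)] carrier_matD[OF P(2)]
    ctranspose_mult M(2)
  have P': "ctranspose P * M = M * P" and Q': "ctranspose Q * M = M * Q"
    using herm M P by (simp_all add: ctranspose_mult)
  \<comment> \<open>Self-adjointness moves \<open>Q\<close> and then \<open>P\<close> to the left of
    \<open>M\<close> as adjoints. There they combine to the adjoint of \<open>P * Q = Q\<close>, and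
    \<open>M\<close> is cancelled at the end.\<close>
  have "M * P = M * (Q * P)" using P by simp
  also have "\<dots> = ctranspose Q * M * P" unfolding Q' by (simp add: assoc del: assoc_mult_mat)
  also have "\<dots> = ctranspose Q * (ctranspose P * M)" unfolding P' by (simp add: assoc del: assoc_mult_mat)
  also have "\<dots> = ctranspose (P * Q) * M" by (simp add: assoc del: assoc_mult_mat)
  also have "\<dots> = M * Q" unfolding P(4) Q' ..
  finally have eq: "M' * (M * P) = M' * (M * Q)" by simp
  then show ?thesis
    using M P by (simp add: assoc_mult_mat[of M' m m M m _ m, symmetric] del: assoc_mult_mat)
qed

lemma weighted_projection_eq_kernel:
  assumes M: "M \<in> carrier_mat m m" "ctranspose M = M" "M' \<in> carrier_mat m m" "M' * M = 1\<^sub>m m"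
    and P: "P \<in> carrier_mat m m" "Q \<in> carrier_mat m m" "P * Q = P" "Q * P = Q"
    and herm: "ctranspose (M * P) = M * P" "ctranspose (M * Q) = M * Q"
  shows "P = Q"
proof -
  note assoc = mat_mult_assoc carrier_matD[OF M(1)] carrier_matD[OF P(1)] carrier_matD[OF P(2)]
    ctranspose_mult M(2)
  have P': "ctranspose P * M = M * P" and Q': "ctranspose Q * M = M * Q"
    using herm M P by (simp_all add: ctranspose_mult)
  have "M * P = M * P * Q" using M P by simp
  also have "\<dots> = ctranspose P * (M * Q)" unfolding P'[symmetric] by (simp add: assoc del: assoc_mult_mat)
  also have "\<dots> = ctranspose (Q * P) * M" unfolding Q'[symmetric] by (simp add: assoc del: assoc_mult_mat)
  also have "\<dots> = M * Q" unfolding P(4) Q' ..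
  finally have eq: "M' * (M * P) = M' * (M * Q)" by simp
  then show ?thesis
    using M P by (simp add: assoc_mult_mat[of M' m m M m _ m, symmetric] del: assoc_mult_mat)
qed

text \<open>\<open>A X\<close> and \<open>A Y\<close> are \<open>M\<close>-self-adjoint idempotents
  with the range of \<open>A\<close>, and \<open>X A\<close> and \<open>Y A\<close> are
  \<open>N\<close>-self-adjoint idempotents with the kernel of \<open>A\<close>; so they agree in
  pairs, and \<open>X = X A X = Y A X = Y A Y = Y\<close>.\<close>

lemma weighted_mp_inverse_unique:
  assumes A: "A \<in> carrier_mat m n" and Mp: "qmat_posdef m M" and Np: "qmat_posdef n N"
    and X: "is_weighted_mp_inverse M N A X" and Y: "is_weighted_mp_inverse M N A Y"
  shows "X = Y"
proof -
  note M = qmat_posdefD(2,3)[OF Mp] posdef_inverse(1,4)[OF Mp]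
    and N = qmat_posdefD(2,3)[OF Np] posdef_inverse(1,4)[OF Np]
  have Xc: "X \<in> carrier_mat n m" and Yc: "Y \<in> carrier_mat n m"
    using X Y A by (auto simp: is_weighted_mp_inverse_def)
  note d = carrier_matD[OF A] carrier_matD[OF Xc] carrier_matD[OF Yc] carrier_matD[OF M(1)] carrier_matD[OF N(1)]
  note X' = X[unfolded is_weighted_mp_inverse_def] and Y' = Y[unfolded is_weighted_mp_inverse_def]
  have AX: "A * X = A * Y"
  proof (rule weighted_projection_eq_range[OF M])
    show "A * X \<in> carrier_mat m m" "A * Y \<in> carrier_mat m m" using A Xc Yc by auto
    have "A * Y * (A * X) = A * Y * A * X" "A * X * (A * Y) = A * X * A * Y"
      by (simp_all add: mat_mult_assoc d del: assoc_mult_mat)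
    then show "A * Y * (A * X) = A * X" "A * X * (A * Y) = A * Y" using X' Y' by simp_all
    have "M * (A * X) = M * A * X" "M * (A * Y) = M * A * Y"
      by (simp_all add: mat_mult_assoc d del: assoc_mult_mat)
    then show "ctranspose (M * (A * X)) = M * (A * X)" "ctranspose (M * (A * Y)) = M * (A * Y)"
      using X' Y' by simp_all
  qed
  have XA: "X * A = Y * A"
  proof (rule weighted_projection_eq_kernel[OF N])
    show "X * A \<in> carrier_mat n n" "Y * A \<in> carrier_mat n n" using A Xc Yc by auto
    have "X * A * (Y * A) = X * (A * Y * A)" "Y * A * (X * A) = Y * (A * X * A)"
      by (simp_all add: mat_mult_assoc d del: assoc_mult_mat)
    then show "X * A * (Y * A) = X * A" "Y * A * (X * A) = Y * A" using X' Y' by simp_all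
    have "N * (X * A) = N * X * A" "N * (Y * A) = N * Y * A"
      by (simp_all add: mat_mult_assoc d del: assoc_mult_mat)
    then show "ctranspose (N * (X * A)) = N * (X * A)" "ctranspose (N * (Y * A)) = N * (Y * A)"
      using X' Y' by simp_all
  qed
  have "X = X * A * X" using X' by simp
  also have "\<dots> = Y * A * X" unfolding XA ..
  also have "\<dots> = Y * (A * X)" by (simp add: mat_mult_assoc d del: assoc_mult_mat)
  also have "\<dots> = Y * A * Y" unfolding AX by (simp add: mat_mult_assoc d del: assoc_mult_mat)
  also have "\<dots> = Y" using Y' by simp
  finally show ?thesis .
qed

lemma weighted_mp_inverse_eqI:
  assumes "A \<in> carrier_mat m n" "qmat_posdef m M" "qmat_posdef n N" "is_weighted_mp_inverse M N A X"
  shows "weighted_mp_inverse M N A = X"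
  unfolding weighted_mp_inverse_def
  using assms(4) weighted_mp_inverse_unique[OF assms(1-3) _ assms(4)] by (rule the_equality)

text \<open>The trailing factor \<open>X\<close> lets an inverse pair cancel inside a
  right-associated product.\<close>

lemma mat_left_cancel:
  fixes A B :: "'a::semiring_1 mat"
  assumes "A \<in> carrier_mat n k" "B \<in> carrier_mat k n" "A * B = 1\<^sub>m n" "dim_row X = n"
  shows "A * (B * X) = X"
proof -
  have "A * (B * X) = A * B * X" using assms by (intro assoc_mult_mat[symmetric]) auto
  also have "\<dots> = X" unfolding assms(3) using assms(4) by (intro left_mult_one_mat) auto
  finally show ?thesis .
qed

theorem theorem3p2:
  fixes m n r :: nat and A M N :: "quat mat"
  assumes "A \<in> carrier_mat m n"
    and "qmat_rank A = r"
    and "qmat_posdef m M"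
    and "qmat_posdef n N"
  shows "(\<exists>U V \<sigma>. is_weighted_svd m n r M N A U V \<sigma>) \<and>
    (\<forall>U V \<sigma>. is_weighted_svd m n r M N A U V \<sigma> \<longrightarrow>
       weighted_mp_inverse M N A =
         qmat_inv N * V * pad_zero n m (qmat_inv (sigma_mat r \<sigma>)) * ctranspose U * M \<and>
       nonzero_eigenvalues_are (weighted_adjoint M N A * A) r (\<lambda>i. (\<sigma> i)\<^sup>2) \<and>
       nonzero_eigenvalues_are (A * weighted_adjoint M N A) r (\<lambda>i. (\<sigma> i)\<^sup>2))"
proof -
  note M = qmat_posdefD(2,3)[OF assms(3)] and N = qmat_posdefD(2,3)[OF assms(4)]
  note K = posdef_inverse[OF assms(4)]
  let ?K = "qmat_inv N"
  \<comment> \<open>The number \<open>s\<close> is arbitrary because this is applied both to the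
    constructed decomposition, before its \<open>s\<close> is known to be the rank, and to a given
    one with \<open>r\<close>.\<close>
  have inverses: "U \<in> carrier_mat m m" "V \<in> carrier_mat n n"
      "U * (ctranspose U * M) = 1\<^sub>m m" "ctranspose U * M * U = 1\<^sub>m m"
      "?K * V * ctranspose V = 1\<^sub>m n" "ctranspose V * (?K * V) = 1\<^sub>m n"
    if svd: "is_weighted_svd m n s M N A U V \<sigma>" for s U V \<sigma>
  proof -
    show U: "U \<in> carrier_mat m m" and V: "V \<in> carrier_mat n n" and UMU: "ctranspose U * M * U = 1\<^sub>m m"
      using svd by (auto simp: is_weighted_svd_def)
    show "U * (ctranspose U * M) = 1\<^sub>m m" by (rule orthonormal_basis_inverse(1)[OF M(1) U UMU])
    show 1: "ctranspose V * (?K * V) = 1\<^sub>m n"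
      using svd carrier_matD[OF V] carrier_matD[OF K(1)]
      by (simp add: is_weighted_svd_def mat_mult_assoc del: assoc_mult_mat)
    show "?K * V * ctranspose V = 1\<^sub>m n"
      using V K(1) by (intro mat_left_inverse_imp_right_inverse[OF _ _ 1]) auto
  qed
  obtain s U0 V0 \<sigma>0 where svd0: "s \<le> m" "s \<le> n" "is_weighted_svd m n s M N A U0 V0 \<sigma>0"
    using weighted_svd_exists[OF assms(1,3,4)] by blast
  \<comment> \<open>Both outer factors are invertible, so the rank counts the nonzero diagonal
    entries, which are the \<open>s\<close> singular values.\<close>
  have "qmat_rank A = s"
  proof -
    note i = inverses[OF svd0(3)]
    have A_eq: "A = U0 * rdiag m n (\<lambda>i. if i < s then \<sigma>0 i else 0) * ctranspose V0"
      and pos: "\<forall>i<s. 0 < \<sigma>0 i"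
      using svd0 by (auto simp: is_weighted_svd_def pad_zero_sigma_mat)
    have U': "ctranspose U0 * M \<in> carrier_mat m m" and V': "ctranspose V0 \<in> carrier_mat n n"
      and KV: "?K * V0 \<in> carrier_mat n n"
      using i(1,2) M K by auto
    have "qmat_rank A = card {i. i < m \<and> i < n \<and> (if i < s then \<sigma>0 i else 0) \<noteq> 0}"
      unfolding A_eq by (rule qmat_rank_rdiag[OF i(1) U' i(4) V' KV i(6)])
    also have "{i. i < m \<and> i < n \<and> (if i < s then \<sigma>0 i else 0) \<noteq> 0} = {..<s}"
      using svd0(1,2) pos by (auto split: if_splits)
    finally show ?thesis by simp
  qed
  then have r: "r = s" "r \<le> m" "r \<le> n" using assms(2) svd0 by auto
  have "weighted_mp_inverse M N A =
         ?K * V * pad_zero n m (qmat_inv (sigma_mat r \<sigma>)) * ctranspose U * M \<and>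
       nonzero_eigenvalues_are (weighted_adjoint M N A * A) r (\<lambda>i. (\<sigma> i)\<^sup>2) \<and>
       nonzero_eigenvalues_are (A * weighted_adjoint M N A) r (\<lambda>i. (\<sigma> i)\<^sup>2)"
    if svd: "is_weighted_svd m n r M N A U V \<sigma>" for U V \<sigma>
  proof -
    note i = inverses[OF svd]
    have pos: "\<forall>i<r. 0 < \<sigma> i" using svd by (simp add: is_weighted_svd_def)
    define D where "D = rdiag m n (\<lambda>i. if i < r then \<sigma> i else 0)"
    define E where "E = rdiag n m (\<lambda>i. if i < r then inverse (\<sigma> i) else 0)"
    define D' where "D' = ctranspose D"
    define U' where "U' = ctranspose U"
    define V' where "V' = ctranspose V"
    have E: "pad_zero n m (qmat_inv (sigma_mat r \<sigma>)) = E"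
      using r pos by (simp add: E_def qmat_inv_sigma_mat pad_zero_sigma_mat)
    have A_eq: "A = U * D * V'"
      using svd r by (simp add: is_weighted_svd_def D_def V'_def pad_zero_sigma_mat)
    have D: "D \<in> carrier_mat m n" "E \<in> carrier_mat n m" "D' \<in> carrier_mat n m"
      by (simp_all add: D_def E_def D'_def)
    have UV': "U' \<in> carrier_mat m m" "V' \<in> carrier_mat n n" using i by (simp_all add: U'_def V'_def)
    note dims = carrier_matD[OF M(1)] carrier_matD[OF N(1)] carrier_matD[OF K(1)] carrier_matD[OF i(1)]
      carrier_matD[OF i(2)] carrier_matD[OF D(1)] carrier_matD[OF D(2)] carrier_matD[OF D(3)]
      carrier_matD[OF UV'(1)] carrier_matD[OF UV'(2)]
    have ct: "ctranspose U = U'" "ctranspose V = V'" "ctranspose D = D'" "ctranspose U' = U"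
      "ctranspose V' = V" "ctranspose D' = D" by (simp_all add: U'_def V'_def D'_def)
    have UM: "U' * M \<in> carrier_mat m m" using UV'(1) M(1) by simp
    have UMU: "U' * (M * (U * X)) = X" if "dim_row X = m" for X
      using mat_left_cancel[OF UM i(1) i(4)[folded U'_def] that]
      by (simp add: U'_def mat_mult_assoc dims[unfolded U'_def] del: assoc_mult_mat)
    have VKV: "V' * (?K * (V * X)) = X" if "dim_row X = n" for X
      using mat_left_cancel[of V' n n "?K * V" X] i(2,6) that UV' K(1)
      by (simp add: V'_def mat_mult_assoc dims[unfolded V'_def] del: assoc_mult_mat)
    have NK: "N * (?K * X) = X" if "dim_row X = n" for X
      using mat_left_cancel[OF N(1) K(1) K(3) that] .
    \<comment> \<open>Products are associated to the right, and a weighted pair cancels wherever it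
      heads a product. The diagonal factors stay opaque until this is done.\<close>
    note norm = mat_mult_assoc dims UMU VKV NK ctranspose_mult ct M(2) N(2) K(2)
    \<comment> \<open>\<open>E\<close> is the ordinary Moore-Penrose inverse of \<open>D\<close>;
      the weighted equations for \<open>X\<close> come down to these identities and the symmetry of
      \<open>D * E\<close> and \<open>E * D\<close>.\<close>
    have DED: "D * (E * D) = D" and EDE: "E * (D * E) = E"
      using pos by (auto simp: D_def E_def rdiag_mult intro!: rdiag_cong)
    have DEDX: "D * (E * (D * X)) = D * X" if "dim_row X = n" for X
      using DED that mat_mult_assoc[of D "E * D" X] mat_mult_assoc[of E D X] by (simp add: dims del: assoc_mult_mat)
    have EDEX: "E * (D * (E * X)) = E * X" if "dim_row X = m" for X
      using EDE that mat_mult_assoc[of E "D * E" X] mat_mult_assoc[of D E X] by (simp add: dims del: assoc_mult_mat)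
    define X where "X = ?K * V * E * U' * M"
    have X: "X \<in> carrier_mat n m"
      unfolding X_def by (intro carrier_matI) (simp_all add: dims)
    have DE: "ctranspose (D * E) = D * E" and ED: "ctranspose (E * D) = E * D"
      by (simp_all add: D_def E_def rdiag_mult ctranspose_mult)
    \<comment> \<open>The inner bases cancel, leaving a symmetric diagonal matrix between a factor
      and its own conjugate transpose.\<close>
    have MAX: "M * A * X = M * (U * (D * E) * U') * M"
      unfolding X_def A_eq by (simp add: norm del: assoc_mult_mat)
    have NXA: "N * X * A = V * (E * D) * V'"
      unfolding X_def A_eq by (simp add: norm del: assoc_mult_mat)
    have "is_weighted_mp_inverse M N A X"
      unfolding is_weighted_mp_inverse_def
    proof (intro conjI)
      show "X \<in> carrier_mat (dim_col A) (dim_row A)" using X assms(1) by simp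
      show "A * X * A = A" unfolding X_def A_eq by (simp add: norm DEDX del: assoc_mult_mat)
      show "X * A * X = X" unfolding X_def A_eq by (simp add: norm EDEX del: assoc_mult_mat)
      have "ctranspose (M * (U * (D * E) * U') * M) = M * (U * ctranspose (D * E) * U') * M"
        by (simp add: norm del: assoc_mult_mat)
      then show "ctranspose (M * A * X) = M * A * X" unfolding MAX DE .
      have "ctranspose (V * (E * D) * V') = V * ctranspose (E * D) * V'"
        by (simp add: norm del: assoc_mult_mat)
      then show "ctranspose (N * X * A) = N * X * A" unfolding NXA ED .
    qed
    then have mp: "weighted_mp_inverse M N A = X"
      by (rule weighted_mp_inverse_eqI[OF assms(1,3,4)])
    have sq: "\<forall>i<r. (\<sigma> i)\<^sup>2 \<noteq> 0" using pos by auto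
    have D'D: "D' * D = rdiag n n (\<lambda>i. if i < r then (\<sigma> i)\<^sup>2 else 0)"
      and DD': "D * D' = rdiag m m (\<lambda>i. if i < r then (\<sigma> i)\<^sup>2 else 0)"
      using r by (auto simp: D_def D'_def rdiag_mult power2_eq_square intro!: rdiag_cong)
    \<comment> \<open>The weighted adjoint is \<open>?K * V * D' * U' * M\<close>. In this product
      \<open>U' * M * U\<close> cancels, in the reverse one \<open>V' * ?K * V\<close>; so the two
      are diagonal in the bases \<open>?K * V\<close> and \<open>U\<close>, whose inverses are
      \<open>V'\<close> and \<open>U' * M\<close>.\<close>
    have "weighted_adjoint M N A * A = (?K * V) * (D' * D) * V'"
      unfolding weighted_adjoint_def A_eq by (simp add: norm del: assoc_mult_mat)
    moreover have "nonzero_eigenvalues_are ((?K * V) * (D' * D) * V') r (\<lambda>i. (\<sigma> i)\<^sup>2)"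
      unfolding D'D
      by (rule diagonalized_nonzero_eigenvalues_are[OF _ UV'(2) _ _ r(3) sq])
        (use K(1) i in \<open>auto simp: V'_def\<close>)
    moreover have "A * weighted_adjoint M N A = U * (D * D') * (U' * M)"
      unfolding weighted_adjoint_def A_eq by (simp add: norm del: assoc_mult_mat)
    moreover have "nonzero_eigenvalues_are (U * (D * D') * (U' * M)) r (\<lambda>i. (\<sigma> i)\<^sup>2)"
      unfolding DD'
      by (rule diagonalized_nonzero_eigenvalues_are[OF i(1) _ _ _ r(2) sq])
        (use M(1) i UV' in \<open>auto simp: U'_def\<close>)
    ultimately show ?thesis using mp by (simp only: E X_def U'_def)
  qed
  then show ?thesis using svd0(3) r(1) by blast
qed

end
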